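(* Assume (a) the no-premature-left-contact condition: for every finite $t\ge0$, $\sup_{0\le s\le t}Y_s<0$ on $\{\tau>t\}$; and (b) for every predictable stopping time $\sigma$, $\mathbb P(\{\sigma<\infty\}\cap\{X_{\sigma-}<b(\sigma)\le X_\sigma\})=0$. Define $A_t:=\mathbf 1_{\{\tau\le t\}}$, $A^L_t:=\mathbf 1_{\{\tau_L\le t\}}$, $A^G_t:=\mathbf 1_{\{\tau_G\le t\}}$, and let $\Lambda,\Lambda^L,\Lambda^G$ denote the dual predictable projections (predictable compensators) of $A,A^L,A^G$. Then $A=A^L+A^G$ and $\Lambda=\Lambda^L+\Lambda^G$. Moreover $\Lambda^L=A^L$, so $\Lambda^L$ is purely discontinuous with a single unit jump at $\tau_L$ on $L$, whereas $\Lambda^G$ is continuous.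
   Context: Let $(\Omega,\mathcal F,\mathbb F=(\mathcal F_t)_{t\ge0},\mathbb P)$ be a filtered probability space satisfying the usual conditions. Let $X$ be a càdlàg $\mathbb F$-adapted real-valued process and $b:[0,\infty)\to\mathbb R$ a continuous deterministic function, with $X_0<b(0)$ identically. For $t>0$, $Y_{t-}$, $X_{t-}$ denote left limits. Set $Y_t:=X_t-b(t)$ and $\tau:=\inf\{t\ge0: Y_t\ge 0\}$ (with $\inf\emptyset=\infty$). Let $L:=\{\tau<\infty,\,Y_{\tau-}=0\}$, $G:=\{\tau<\infty,\,Y_{\tau-}<0\}$; define $\tau_L:=\tau$ on $L$, $\tau_L:=\infty$ otherwise, and $\tau_G:=\tau$ on $G$, $\tau_G:=\infty$ otherwise. *)

theory Defs
  imports "HOL-Probability.Probability"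
begin

text \<open>Time parameter: real numbers t with t \<ge> 0; values of processes at t < 0 are irrelevant.
  Random times take values in ereal (with \<infinity> allowed).\<close>

definition usual_conditions :: "'a measure \<Rightarrow> (real \<Rightarrow> 'a measure) \<Rightarrow> bool" where
  "usual_conditions M F \<longleftrightarrow>
     (\<forall>t\<ge>0. space (F t) = space M \<and> sets (F t) \<subseteq> sets M) \<and>
     (\<forall>s t. 0 \<le> s \<and> s \<le> t \<longrightarrow> sets (F s) \<subseteq> sets (F t)) \<and>
     (\<forall>t\<ge>0. sets (F t) = (\<Inter>s\<in>{t<..}. sets (F s))) \<and>
     (\<forall>N\<in>null_sets M. \<forall>B. B \<subseteq> N \<longrightarrow> B \<in> sets M) \<and>
     null_sets M \<subseteq> sets (F 0)"

definition adapted :: "'a measure \<Rightarrow> (real \<Rightarrow> 'a measure) \<Rightarrow> (real \<Rightarrow> 'a \<Rightarrow> real) \<Rightarrow> bool" where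
  "adapted M F X \<longleftrightarrow> (\<forall>t\<ge>0. X t \<in> borel_measurable (F t))"

definition cadlag :: "(real \<Rightarrow> real) \<Rightarrow> bool" where
  "cadlag f \<longleftrightarrow> (\<forall>t\<ge>0. continuous (at_right t) f) \<and>
                (\<forall>t>0. \<exists>l. (f \<longlongrightarrow> l) (at_left t))"

definition cadlag_process :: "'a measure \<Rightarrow> (real \<Rightarrow> 'a \<Rightarrow> real) \<Rightarrow> bool" where
  "cadlag_process M X \<longleftrightarrow> (\<forall>\<omega>\<in>space M. cadlag (\<lambda>t. X t \<omega>))"

definition left_lim :: "(real \<Rightarrow> 'a \<Rightarrow> real) \<Rightarrow> real \<Rightarrow> 'a \<Rightarrow> real" where
  "left_lim X t \<omega> = (if t \<le> 0 then X 0 \<omega> else Lim (at_left t) (\<lambda>s. X s \<omega>))"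

definition predictable_sigma :: "'a measure \<Rightarrow> (real \<Rightarrow> 'a measure) \<Rightarrow> (real \<times> 'a) measure" where
  "predictable_sigma M F = sigma ({0..} \<times> space M)
     ({{0} \<times> A | A. A \<in> sets (F 0)} \<union>
      {{s<..t} \<times> A | s t A. 0 \<le> s \<and> s \<le> t \<and> A \<in> sets (F s)})"

definition predictable_process :: "'a measure \<Rightarrow> (real \<Rightarrow> 'a measure) \<Rightarrow> (real \<Rightarrow> 'a \<Rightarrow> real) \<Rightarrow> bool" where
  "predictable_process M F H \<longleftrightarrow> (\<lambda>(t, \<omega>). H t \<omega>) \<in> borel_measurable (predictable_sigma M F)"

definition stopping_time_F :: "'a measure \<Rightarrow> (real \<Rightarrow> 'a measure) \<Rightarrow> ('a \<Rightarrow> ereal) \<Rightarrow> bool" where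
  "stopping_time_F M F \<sigma> \<longleftrightarrow> (\<forall>\<omega>\<in>space M. 0 \<le> \<sigma> \<omega>) \<and>
     (\<forall>t\<ge>0. {\<omega>\<in>space M. \<sigma> \<omega> \<le> ereal t} \<in> sets (F t))"

definition predictable_time :: "'a measure \<Rightarrow> (real \<Rightarrow> 'a measure) \<Rightarrow> ('a \<Rightarrow> ereal) \<Rightarrow> bool" where
  "predictable_time M F \<sigma> \<longleftrightarrow> stopping_time_F M F \<sigma> \<and>
     {(t, \<omega>). 0 \<le> t \<and> \<omega> \<in> space M \<and> \<sigma> \<omega> \<le> ereal t} \<in> sets (predictable_sigma M F)"

text \<open>Pathwise Lebesgue-Stieltjes measure dA(\<omega>) on [0,\<infinity>) of a nondecreasing right-continuous
  path (including an atom A_0 at time 0).\<close>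
definition path_measure :: "(real \<Rightarrow> 'a \<Rightarrow> real) \<Rightarrow> 'a \<Rightarrow> real measure" where
  "path_measure A \<omega> = interval_measure (\<lambda>t. if t < 0 then 0 else A t \<omega>)"

definition increasing_process :: "'a measure \<Rightarrow> (real \<Rightarrow> 'a \<Rightarrow> real) \<Rightarrow> bool" where
  "increasing_process M A \<longleftrightarrow> (\<forall>\<omega>\<in>space M. 0 \<le> A 0 \<omega> \<and>
      (\<forall>s t. 0 \<le> s \<and> s \<le> t \<longrightarrow> A s \<omega> \<le> A t \<omega>) \<and>
      (\<forall>t\<ge>0. continuous (at_right t) (\<lambda>s. A s \<omega>)))"

definition dual_predictable_projection ::
  "'a measure \<Rightarrow> (real \<Rightarrow> 'a measure) \<Rightarrow> (real \<Rightarrow> 'a \<Rightarrow> real) \<Rightarrow> (real \<Rightarrow> 'a \<Rightarrow> real) \<Rightarrow> bool" where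
  "dual_predictable_projection M F A \<Lambda> \<longleftrightarrow>
     predictable_process M F \<Lambda> \<and> increasing_process M \<Lambda> \<and>
     (\<forall>H. predictable_process M F H \<and> (\<forall>t \<omega>. 0 \<le> H t \<omega>) \<longrightarrow>
        (\<integral>\<^sup>+ \<omega>. (\<integral>\<^sup>+ t. ennreal (H t \<omega>) \<partial>path_measure \<Lambda> \<omega>) \<partial>M) =
        (\<integral>\<^sup>+ \<omega>. (\<integral>\<^sup>+ t. ennreal (H t \<omega>) \<partial>path_measure A \<omega>) \<partial>M))"

definition hit_time :: "(real \<Rightarrow> 'a \<Rightarrow> real) \<Rightarrow> (real \<Rightarrow> real) \<Rightarrow> 'a \<Rightarrow> ereal" where
  "hit_time X b \<omega> = Inf (ereal ` {t. 0 \<le> t \<and> 0 \<le> X t \<omega> - b t})"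

definition Yproc :: "(real \<Rightarrow> 'a \<Rightarrow> real) \<Rightarrow> (real \<Rightarrow> real) \<Rightarrow> real \<Rightarrow> 'a \<Rightarrow> real" where
  "Yproc X b t \<omega> = X t \<omega> - b t"

definition L_event :: "(real \<Rightarrow> 'a \<Rightarrow> real) \<Rightarrow> (real \<Rightarrow> real) \<Rightarrow> 'a \<Rightarrow> bool" where
  "L_event X b \<omega> \<longleftrightarrow> hit_time X b \<omega> < \<infinity> \<and>
     left_lim (Yproc X b) (real_of_ereal (hit_time X b \<omega>)) \<omega> = 0"

definition G_event :: "(real \<Rightarrow> 'a \<Rightarrow> real) \<Rightarrow> (real \<Rightarrow> real) \<Rightarrow> 'a \<Rightarrow> bool" where
  "G_event X b \<omega> \<longleftrightarrow> hit_time X b \<omega> < \<infinity> \<and>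
     left_lim (Yproc X b) (real_of_ereal (hit_time X b \<omega>)) \<omega> < 0"

definition hit_time_L :: "(real \<Rightarrow> 'a \<Rightarrow> real) \<Rightarrow> (real \<Rightarrow> real) \<Rightarrow> 'a \<Rightarrow> ereal" where
  "hit_time_L X b \<omega> = (if L_event X b \<omega> then hit_time X b \<omega> else \<infinity>)"

definition hit_time_G :: "(real \<Rightarrow> 'a \<Rightarrow> real) \<Rightarrow> (real \<Rightarrow> real) \<Rightarrow> 'a \<Rightarrow> ereal" where
  "hit_time_G X b \<omega> = (if G_event X b \<omega> then hit_time X b \<omega> else \<infinity>)"

definition count_proc :: "('a \<Rightarrow> ereal) \<Rightarrow> real \<Rightarrow> 'a \<Rightarrow> real" where
  "count_proc \<sigma> t \<omega> = (if \<sigma> \<omega> \<le> ereal t then 1 else 0)"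

end

theory Submission
  imports Defs
begin

text \<open>A predictable increasing process \<open>U\<close> is determined up to indistinguishability by its Doleans measure
  \<open>S \<mapsto> E (\<integral> 1\<^sub>S dU)\<close> on the predictable sets. Let \<open>V\<close> be another one with the same Doleans measure and
  \<open>D = U - V\<close>. Integration by parts gives \<open>D\<^sub>t\<^sup>2 = \<integral> (D\<^sub>s + D\<^sub>s\<^sub>-) dD\<^sub>s\<close> with a predictable integrand, and the expectation
  of the right-hand side vanishes after localisation to \<open>U + V \<le> n\<close>; no martingale theory is needed.
  This gives \<open>\<Lambda> = \<Lambda>L + \<Lambda>G\<close>, and also \<open>\<Lambda>L = A\<^sup>L\<close> once \<open>\<tau>\<^sub>L\<close> is known to be predictable: without premature left
  contact, \<open>Y\<close> comes arbitrarily close to zero before \<open>\<tau>\<close> only on \<open>L\<close>. Finally every jump time of \<open>\<Lambda>G\<close>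
  is the first passage time of \<open>\<Lambda>G\<close> over some rational level. Such a time is predictable, so \<open>\<tau>\<^sub>G\<close> avoids
  it almost surely, and the Doleans measure of \<open>\<Lambda>G\<close> does not charge its graph.\<close>

section \<open>Path measures and the predictable sigma-algebra\<close>

text \<open>Predictability of both processes is essential to the uniqueness argument. The integrand
  of \<open>D\<^sub>t\<^sup>2\<close> contains the value of \<open>D\<close> at the jump time
  itself, not only its left limit, so it is predictable only because \<open>U\<close> and
  \<open>V\<close> are. The same holds for the localising set where \<open>U + V\<close> is at most
  \<open>n\<close>. It ends strictly before a jump that would overshoot \<open>n\<close>, so both
  processes stay bounded on it, jumps included. The price is that its sections may be half-open
  intervals. Masses are nonnegative extended reals, so differences are avoided: the vanishing of the
  expected square is phrased as equality of the expectations of \<open>U * U + V * V\<close> and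
  \<open>U * V + V * U\<close>, and each product is integrated by parts separately. Two general
  theorems on random times are replaced by countable descriptions. The contact condition separates
  \<open>Y\<close> from zero before \<open>\<tau>\<close>, so \<open>{t < \<tau>}\<close> can be
  read off from rational times. A jump of a monotone path leaves a gap containing a rational level,
  so countably many first passage times catch every jump.\<close>

lemma path_measure_increasing_process:
  assumes "increasing_process M U" "\<omega> \<in> space M"
  shows path_measure_greaterThanAtMost:
      "0 \<le> s \<Longrightarrow> s \<le> t \<Longrightarrow> emeasure (path_measure U \<omega>) {s<..t} = ennreal (U t \<omega> - U s \<omega>)"
    and path_measure_atLeastAtMost:
      "0 \<le> t \<Longrightarrow> emeasure (path_measure U \<omega>) {0..t} = ennreal (U t \<omega>)"
proof -
  let ?f = "\<lambda>t. if t < 0 then 0 else U t \<omega>"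
  have U: "0 \<le> U 0 \<omega>" "\<And>s t. 0 \<le> s \<Longrightarrow> s \<le> t \<Longrightarrow> U s \<omega> \<le> U t \<omega>"
     "\<And>t. 0 \<le> t \<Longrightarrow> continuous (at_right t) (\<lambda>s. U s \<omega>)"
    using assms by (auto simp: increasing_process_def)
  have mono: "?f s \<le> ?f t" if "s \<le> t" for s t
    using that U(1) U(2)[of 0 t] U(2)[of s t] by auto
  have cont: "continuous (at_right t) ?f" for t
  proof (cases "t < 0")
    case True
    have "\<forall>\<^sub>F s in at_right t. ?f s = 0"
      unfolding eventually_at_right[OF True] using True by (intro exI[of _ 0]) auto
    then show ?thesis
      using True by (simp add: continuous_within tendsto_eventually)
  next
    case False
    have "\<forall>\<^sub>F s in at_right t. U s \<omega> = ?f s"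
      using False by (auto simp: eventually_at_filter)
    with U(3)[of t] False show ?thesis
      by (auto simp: continuous_within intro: Lim_transform_eventually)
  qed
  note Ioc = emeasure_interval_measure_Ioc[of _ _ ?f, OF _ mono cont]
  show "emeasure (path_measure U \<omega>) {s<..t} = ennreal (U t \<omega> - U s \<omega>)" if "0 \<le> s" "s \<le> t"
    using that Ioc[of s t] by (auto simp: path_measure_def)
  have neg: "emeasure (path_measure U \<omega>) {..<0} = 0"
  proof (rule antisym)
    \<comment> \<open>The covering intervals end strictly below zero, where the extended path is
      constantly zero. An interval reaching zero would pick up the atom
      \<open>U 0 \<omega>\<close>.\<close>
    have "{..<0::real} \<subseteq> (\<Union>n. {- real n<..- 1 / real (Suc n)})"
    proof
      fix x :: real assume "x \<in> {..<0}"
      then have x: "0 < -x" by simp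
      obtain n where n: "-x < real n" using reals_Archimedean2 by blast
      obtain k where k: "inverse (real (Suc k)) < -x" using reals_Archimedean[OF x] by blast
      define m where "m = max n k"
      have "real n \<le> real m" "1 / real (Suc m) \<le> inverse (real (Suc k))"
        by (auto simp: m_def field_simps)
      then show "x \<in> (\<Union>n. {- real n<..- 1 / real (Suc n)})"
        using n k by (intro UN_I[of m]) auto
    qed
    then have "emeasure (path_measure U \<omega>) {..<0}
        \<le> emeasure (path_measure U \<omega>) (\<Union>n. {- real n<..- 1 / real (Suc n)})"
      by (intro emeasure_mono) (auto simp: path_measure_def)
    also have "\<dots> \<le> (\<Sum>n. emeasure (path_measure U \<omega>) {- real n<..- 1 / real (Suc n)})"
      by (intro emeasure_subadditive_countably) (auto simp: path_measure_def)
    also have "\<dots> = 0"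
    proof -
      have "emeasure (path_measure U \<omega>) {- real n<..- 1 / real (Suc n)} = 0" for n
      proof (cases "- real n \<le> - 1 / real (Suc n)")
        case True
        then show ?thesis
          unfolding path_measure_def by (subst Ioc) auto
      qed auto
      then show ?thesis by simp
    qed
    finally show "emeasure (path_measure U \<omega>) {..<0} \<le> 0" .
  qed simp
  show "emeasure (path_measure U \<omega>) {0..t} = ennreal (U t \<omega>)" if "0 \<le> t"
  proof -
    \<comment> \<open>Adding the null negative half-line to \<open>{0..t}\<close> and to
      \<open>{-1<..t}\<close> gives the same set. Hence the closed interval has the mass given by
      the formula for half-open ones, with value zero at \<open>-1\<close>.\<close>
    have eq: "{-1<..t} \<union> {..<0} = {..<0} \<union> {0..t}" using that by auto
    have "emeasure (path_measure U \<omega>) {0..t} = emeasure (path_measure U \<omega>) ({..<0} \<union> {0..t})"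
      using neg that by (subst Un_commute, subst emeasure_Un_null_set) (auto simp: null_sets_def path_measure_def)
    also have "\<dots> = emeasure (path_measure U \<omega>) {-1<..t}"
      unfolding eq[symmetric]
      using neg that by (subst emeasure_Un_null_set) (auto simp: null_sets_def path_measure_def)
    finally show ?thesis
      using that unfolding path_measure_def by (subst (asm) Ioc) auto
  qed
qed

lemma sets_path_measure [simp, measurable_cong]: "sets (path_measure U \<omega>) = sets borel"
  by (simp add: path_measure_def)

lemma space_path_measure [simp]: "space (path_measure U \<omega>) = UNIV"
  by (simp add: path_measure_def)

section \<open>Predictable rectangles and sections of predictable sets\<close>

locale usual_filtration =
  fixes M :: "'a measure" and F :: "real \<Rightarrow> 'a measure"
  assumes usual: "usual_conditions M F"
begin

lemma space_F:
  assumes "0 \<le> t"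
  shows "space (F t) = space M"
proof -
  have "\<forall>t\<ge>0. space (F t) = space M \<and> sets (F t) \<subseteq> sets M"
    using usual unfolding usual_conditions_def by (elim conjE)
  with assms show ?thesis by blast
qed

lemma sets_F_M:
  assumes "0 \<le> t" "A \<in> sets (F t)"
  shows "A \<in> sets M"
proof -
  have "\<forall>t\<ge>0. space (F t) = space M \<and> sets (F t) \<subseteq> sets M"
    using usual unfolding usual_conditions_def by (elim conjE)
  with assms show ?thesis by blast
qed

lemma sets_F_mono:
  assumes "0 \<le> s" "s \<le> t" "A \<in> sets (F s)"
  shows "A \<in> sets (F t)"
proof -
  have "\<forall>s t. 0 \<le> s \<and> s \<le> t \<longrightarrow> sets (F s) \<subseteq> sets (F t)"
    using usual unfolding usual_conditions_def by (elim conjE)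
  with assms show ?thesis by blast
qed

definition rectangles :: "(real \<times> 'a) set set" where
  "rectangles = {{0} \<times> A | A. A \<in> sets (F 0)} \<union>
     {{s<..t} \<times> A | s t A. 0 \<le> s \<and> s \<le> t \<and> A \<in> sets (F s)}"

lemma zero_rectangle: "A \<in> sets (F 0) \<Longrightarrow> {0} \<times> A \<in> rectangles"
  unfolding rectangles_def by (rule UnI1, rule CollectI, rule exI, rule conjI[OF refl])

lemma Ioc_rectangle: "0 \<le> s \<Longrightarrow> s \<le> t \<Longrightarrow> A \<in> sets (F s) \<Longrightarrow> {s<..t} \<times> A \<in> rectangles"
  unfolding rectangles_def by (rule UnI2, rule CollectI, (rule exI)+, rule conjI[OF refl]) simp

lemma rectangles_cases:
  assumes "S \<in> rectangles"
  obtains (zero) A where "S = {0} \<times> A" "A \<in> sets (F 0)"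
    | (Ioc) s t A where "S = {s<..t} \<times> A" "0 \<le> s" "s \<le> t" "A \<in> sets (F s)"
  using assms unfolding rectangles_def by (elim UnE CollectE exE conjE) auto

lemma rectangles_subset: "rectangles \<subseteq> Pow ({0..} \<times> space M)"
proof
  fix S assume "S \<in> rectangles"
  then show "S \<in> Pow ({0..} \<times> space M)"
  proof (cases rule: rectangles_cases)
    case (zero A)
    then show ?thesis using sets.sets_into_space[OF zero(2)] space_F by auto
  next
    case (Ioc s t A)
    then show ?thesis using sets.sets_into_space[OF Ioc(4)] space_F by auto
  qed
qed

lemma predictable_sigma_eq: "predictable_sigma M F = sigma ({0..} \<times> space M) rectangles"
  unfolding predictable_sigma_def rectangles_def ..

lemma space_predictable_sigma [simp]: "space (predictable_sigma M F) = {0..} \<times> space M"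
  unfolding predictable_sigma_eq by (rule space_measure_of[OF rectangles_subset])

lemma sets_predictable_sigma:
  "sets (predictable_sigma M F) = sigma_sets ({0..} \<times> space M) rectangles"
  unfolding predictable_sigma_eq by (rule sets_measure_of[OF rectangles_subset])

lemma Int_stable_rectangles: "Int_stable rectangles"
proof (rule Int_stableI)
  have null: "{} \<in> rectangles"
    using zero_rectangle[of "{}"] by simp
  fix a b assume a: "a \<in> rectangles" and b: "b \<in> rectangles"
  from a show "a \<inter> b \<in> rectangles"
  proof (cases rule: rectangles_cases)
    case a: (zero A)
    from b show ?thesis
    proof (cases rule: rectangles_cases)
      case b: (zero B)
      have "a \<inter> b = {0} \<times> (A \<inter> B)" using a b by auto
      then show ?thesis using a b zero_rectangle[of "A \<inter> B"] by simp
    next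
      case (Ioc s t B)
      then have "a \<inter> b = {}" using a by auto
      then show ?thesis using null by simp
    qed
  next
    case a: (Ioc s t A)
    from b show ?thesis
    proof (cases rule: rectangles_cases)
      case (zero B)
      then have "a \<inter> b = {}" using a by auto
      then show ?thesis using null by simp
    next
      case b: (Ioc s' t' B)
      show ?thesis
      proof (cases "max s s' \<le> min t t'")
        case True
        have "A \<in> sets (F (max s s'))" "B \<in> sets (F (max s s'))"
          using a b sets_F_mono[of s "max s s'"] sets_F_mono[of s' "max s s'"] by auto
        then have "A \<inter> B \<in> sets (F (max s s'))" by blast
        moreover have "a \<inter> b = {max s s'<..min t t'} \<times> (A \<inter> B)" using a b by auto
        moreover have "0 \<le> max s s'" using a by simp
        ultimately show ?thesis
          using True by (metis Ioc_rectangle)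
      next
        case False
        then have "a \<inter> b = {}" using a b by auto
        then show ?thesis using null by simp
      qed
    qed
  qed
qed

lemma predictable_section:
  assumes "S \<in> sets (predictable_sigma M F)" "\<omega> \<in> space M"
  shows "(\<lambda>t. (t, \<omega>)) -` S \<in> sets borel"
proof -
  have "S \<in> sigma_sets ({0..} \<times> space M) rectangles" using assms(1) by (simp add: sets_predictable_sigma)
  then show ?thesis
  proof (induction rule: sigma_sets.induct)
    case (Basic S)
    then show ?case
    proof (cases rule: rectangles_cases)
      case (zero A)
      then have "(\<lambda>t. (t, \<omega>)) -` S = (if \<omega> \<in> A then {0} else {})" by auto
      then show ?thesis by simp
    next
      case (Ioc s t A)
      then have "(\<lambda>t. (t, \<omega>)) -` S = (if \<omega> \<in> A then {s<..t} else {})" by auto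
      then show ?thesis by simp
    qed
  next
    case (Compl S)
    have "(\<lambda>t. (t, \<omega>)) -` ({0..} \<times> space M - S) = {0..} - (\<lambda>t. (t, \<omega>)) -` S"
      using assms(2) by auto
    with Compl show ?case by simp
  next
    case (Union a)
    show ?case unfolding vimage_UN by (intro sets.countable_UN) (use Union in auto)
  next
    case Empty
    then show ?case by simp
  qed
qed

text \<open>A rectangle \<open>{s<..t'} \<times> A\<close> shows \<open>A\<close> only at times
  after \<open>s\<close>, when \<open>A\<close> already belongs to the filtration. Consequently a
  predictable process is adapted.\<close>

lemma adapted_section:
  assumes "S \<in> sets (predictable_sigma M F)" "0 \<le> t"
  shows "Pair t -` S \<in> sets (F t)"
proof -
  have "S \<in> sigma_sets ({0..} \<times> space M) rectangles" using assms(1) by (simp add: sets_predictable_sigma)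
  then show ?thesis
  proof (induction rule: sigma_sets.induct)
    case (Basic S)
    then show ?case
    proof (cases rule: rectangles_cases)
      case (zero A)
      then have "Pair t -` S = (if t = 0 then A else {})" by auto
      then show ?thesis using zero by simp
    next
      case (Ioc s t' A)
      then have "Pair t -` S = (if s < t \<and> t \<le> t' then A else {})" by auto
      then show ?thesis using Ioc sets_F_mono[of s t A] by simp
    qed
  next
    case (Compl S)
    have "Pair t -` ({0..} \<times> space M - S) = space (F t) - Pair t -` S"
      using assms(2) by (auto simp: space_F)
    with Compl show ?case by simp
  next
    case (Union a)
    show ?case unfolding vimage_UN by (intro sets.countable_UN) (use Union in auto)
  next
    case Empty
    then show ?case by simp
  qed
qed

lemma predictable_process_measurable:
  assumes "predictable_process M F U" "0 \<le> t"
  shows "U t \<in> borel_measurable (F t)"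
proof (rule measurableI)
  fix B :: "real set" assume B: "B \<in> sets borel"
  have "(\<lambda>(t, \<omega>). U t \<omega>) -` B \<inter> ({0..} \<times> space M) \<in> sets (predictable_sigma M F)"
    using measurable_sets[OF assms(1)[unfolded predictable_process_def] B] by simp
  from adapted_section[OF this assms(2)]
  show "U t -` B \<inter> space (F t) \<in> sets (F t)"
    using assms(2) by (simp add: space_F vimage_def Int_def)
qed simp

lemma predictable_process_measurable_M:
  assumes "predictable_process M F U" "0 \<le> t"
  shows "U t \<in> borel_measurable M"
proof (rule measurable_from_subalg)
  show "subalgebra M (F t)"
    using sets_F_M[OF assms(2)] space_F[OF assms(2)] by (auto simp: subalgebra_def)
  show "U t \<in> borel_measurable (F t)" using assms by (rule predictable_process_measurable)
qed

end

section \<open>The Doleans measure of an increasing process\<close>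

context usual_filtration
begin

text \<open>Induction over the intersection-stable rectangles. The complement step subtracts masses,
  which requires a finite total, so the claim is first proved for the path measure cut off at
  \<open>N\<close>, where the total is \<open>U N \<omega>\<close>. The cut-off is then removed by a
  monotone limit.\<close>

lemma measurable_path_measure_section:
  assumes inc: "increasing_process M U"
    and meas: "\<And>t. 0 \<le> t \<Longrightarrow> U t \<in> borel_measurable M"
    and S: "S \<in> sets (predictable_sigma M F)"
  shows "(\<lambda>\<omega>. emeasure (path_measure U \<omega>) ((\<lambda>t. (t, \<omega>)) -` S)) \<in> borel_measurable M"
proof -
  let ?e = "\<lambda>N S \<omega>. emeasure (path_measure U \<omega>) ((\<lambda>t. (t, \<omega>)) -` S \<inter> {0..real N})"
  have sect: "(\<lambda>t. (t, \<omega>)) -` S \<in> sets borel"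
    if "S \<in> sigma_sets ({0..} \<times> space M) rectangles" "\<omega> \<in> space M" for S \<omega>
    using predictable_section that by (simp add: sets_predictable_sigma)
  have trunc: "?e N S \<in> borel_measurable M" for N
  proof -
    have "S \<in> sigma_sets ({0..} \<times> space M) rectangles"
      using S by (simp add: sets_predictable_sigma)
    with Int_stable_rectangles rectangles_subset show ?thesis
    proof (induction rule: sigma_sets_induct_disjoint)
      case (basic S)
      then show ?case
      proof (cases rule: rectangles_cases)
        case (zero A)
        have A: "A \<in> sets M" using sets_F_M[of 0 A] zero by simp
        have "?e N S \<omega> = indicator A \<omega> * ennreal (U 0 \<omega>)" if "\<omega> \<in> space M" for \<omega>
        proof -
          have "(\<lambda>t. (t, \<omega>)) -` S \<inter> {0..real N} = (if \<omega> \<in> A then {0..0} else {})"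
            using zero by auto
          then show ?thesis
            using path_measure_atLeastAtMost[OF inc that, of 0] by (simp add: indicator_def)
        qed
        then show ?thesis
          using A meas[of 0] by (simp cong: measurable_cong)
      next
        case (Ioc s t A)
        have A: "A \<in> sets M" using sets_F_M[of s A] Ioc by simp
        \<comment> \<open>The outer \<open>max\<close> covers \<open>N < s\<close>: the truncated
          interval is then empty, and the formula returns
          \<open>U s \<omega> - U s \<omega> = 0\<close>.\<close>
        have "?e N S \<omega> = indicator A \<omega> * ennreal (U (max s (min t N)) \<omega> - U s \<omega>)"
          if "\<omega> \<in> space M" for \<omega>
        proof -
          have "(\<lambda>t. (t, \<omega>)) -` S \<inter> {0..real N} = (if \<omega> \<in> A then {s<..max s (min t N)} else {})"
            using Ioc by auto
          then show ?thesis
            using path_measure_greaterThanAtMost[OF inc that, of s "max s (min t N)"] Ioc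
            by (simp add: indicator_def)
        qed
        then show ?thesis
          using A Ioc meas[of s] meas[of "max s (min t N)"] by (simp cong: measurable_cong)
      qed
    next
      case empty
      then show ?case by simp
    next
      case (compl S)
      have "?e N ({0..} \<times> space M - S) \<omega> = ennreal (U N \<omega>) - ?e N S \<omega>" if "\<omega> \<in> space M" for \<omega>
      proof -
        have "(\<lambda>t. (t, \<omega>)) -` ({0..} \<times> space M - S) \<inter> {0..real N}
            = {0..real N} - (\<lambda>t. (t, \<omega>)) -` S \<inter> {0..real N}"
          using that by auto
        moreover have "?e N S \<omega> \<noteq> \<infinity>"
        proof -
          have "?e N S \<omega> \<le> emeasure (path_measure U \<omega>) {0..real N}"
            by (intro emeasure_mono) auto
          also have "\<dots> < \<infinity>"
            using path_measure_atLeastAtMost[OF inc that, of N] by simp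
          finally show ?thesis by simp
        qed
        ultimately show ?thesis
          using sect[OF compl(1) that] path_measure_atLeastAtMost[OF inc that, of N]
          by (simp add: emeasure_Diff)
      qed
      then show ?case
        using compl(2) meas[of N] by (simp cong: measurable_cong)
    next
      case (union A)
      have "?e N (\<Union>i. A i) \<omega> = (\<Sum>i. ?e N (A i) \<omega>)" if "\<omega> \<in> space M" for \<omega>
      proof -
        have "(\<lambda>t. (t, \<omega>)) -` (\<Union>i. A i) \<inter> {0..real N} = (\<Union>i. (\<lambda>t. (t, \<omega>)) -` A i \<inter> {0..real N})"
          by auto
        then show ?thesis
          using union(1,2) sect[OF _ that]
          by (simp only:) (intro suminf_emeasure[symmetric], auto simp: disjoint_family_on_def)
      qed
      then show ?case
        using union(3) by (simp cong: measurable_cong)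
    qed
  qed
  have "emeasure (path_measure U \<omega>) ((\<lambda>t. (t, \<omega>)) -` S) = (SUP N. ?e N S \<omega>)"
    if "\<omega> \<in> space M" for \<omega>
  proof -
    have "S \<subseteq> {0..} \<times> space M" using sets.sets_into_space[OF S] by simp
    then have "(\<lambda>t. (t, \<omega>)) -` S = (\<Union>N. (\<lambda>t. (t, \<omega>)) -` S \<inter> {0..real N})"
      by (auto intro: real_arch_simple)
    moreover have "(SUP N. ?e N S \<omega>) = emeasure (path_measure U \<omega>) (\<Union>N. (\<lambda>t. (t, \<omega>)) -` S \<inter> {0..real N})"
      using predictable_section[OF S that] by (intro SUP_emeasure_incseq) (auto simp: incseq_def)
    ultimately show ?thesis by simp
  qed
  then show ?thesis
    using trunc by (simp cong: measurable_cong)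
qed

text \<open>The domain is deliberately the predictable sigma-algebra and not the full product: a
  process and its compensator give the same mass to predictable sets, but in general not to other
  measurable sets.\<close>

definition doleans :: "(real \<Rightarrow> 'a \<Rightarrow> real) \<Rightarrow> (real \<times> 'a) measure" where
  "doleans U = measure_of ({0..} \<times> space M) (sets (predictable_sigma M F))
     (\<lambda>S. \<integral>\<^sup>+\<omega>. emeasure (path_measure U \<omega>) ((\<lambda>t. (t, \<omega>)) -` S) \<partial>M)"

lemma sets_doleans [simp, measurable_cong]: "sets (doleans U) = sets (predictable_sigma M F)"
  unfolding doleans_def using sets.sets_measure_of_eq[of "predictable_sigma M F"] by simp

lemma space_doleans [simp]: "space (doleans U) = {0..} \<times> space M"
  using sets_eq_imp_space_eq[OF sets_doleans] by simp

lemma emeasure_doleans: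
  assumes inc: "increasing_process M U"
    and meas: "\<And>t. 0 \<le> t \<Longrightarrow> U t \<in> borel_measurable M"
    and S: "S \<in> sets (predictable_sigma M F)"
  shows "emeasure (doleans U) S = (\<integral>\<^sup>+\<omega>. emeasure (path_measure U \<omega>) ((\<lambda>t. (t, \<omega>)) -` S) \<partial>M)"
proof (rule emeasure_measure_of[OF doleans_def])
  show "sets (predictable_sigma M F) \<subseteq> Pow ({0..} \<times> space M)"
    using sets.space_closed[of "predictable_sigma M F"] by simp
  show "S \<in> sets (doleans U)" using S by simp
  show "positive (sets (doleans U)) (\<lambda>S. \<integral>\<^sup>+\<omega>. emeasure (path_measure U \<omega>) ((\<lambda>t. (t, \<omega>)) -` S) \<partial>M)"
    by (simp add: positive_def)
  show "countably_additive (sets (doleans U))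
     (\<lambda>S. \<integral>\<^sup>+\<omega>. emeasure (path_measure U \<omega>) ((\<lambda>t. (t, \<omega>)) -` S) \<partial>M)"
  proof (rule countably_additiveI)
    fix A :: "nat \<Rightarrow> (real \<times> 'a) set"
    assume A: "range A \<subseteq> sets (doleans U)" "disjoint_family A"
    then have A': "A i \<in> sets (predictable_sigma M F)" for i by auto
    have "(\<Sum>i. \<integral>\<^sup>+\<omega>. emeasure (path_measure U \<omega>) ((\<lambda>t. (t, \<omega>)) -` A i) \<partial>M)
        = (\<integral>\<^sup>+\<omega>. (\<Sum>i. emeasure (path_measure U \<omega>) ((\<lambda>t. (t, \<omega>)) -` A i)) \<partial>M)"
      by (intro nn_integral_suminf[symmetric] measurable_path_measure_section inc meas A')
    also have "\<dots> = (\<integral>\<^sup>+\<omega>. emeasure (path_measure U \<omega>) ((\<lambda>t. (t, \<omega>)) -` (\<Union>i. A i)) \<partial>M)"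
      unfolding vimage_UN using A(2) predictable_section[OF A']
      by (intro nn_integral_cong suminf_emeasure) (auto simp: disjoint_family_on_def)
    finally show "(\<Sum>i. \<integral>\<^sup>+\<omega>. emeasure (path_measure U \<omega>) ((\<lambda>t. (t, \<omega>)) -` A i) \<partial>M)
        = (\<integral>\<^sup>+\<omega>. emeasure (path_measure U \<omega>) ((\<lambda>t. (t, \<omega>)) -` (\<Union>i. A i)) \<partial>M)" .
  qed
qed

lemma measurable_section_function:
  fixes f :: "real \<times> 'a \<Rightarrow> ennreal"
  assumes f: "f \<in> borel_measurable (predictable_sigma M F)" and \<omega>: "\<omega> \<in> space M"
  shows "(\<lambda>t. f (t, \<omega>) * indicator {0..} t) \<in> borel_measurable borel"
proof -
  have "(\<lambda>t. (t, \<omega>)) \<in> measurable (restrict_space borel {0..}) (predictable_sigma M F)"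
  proof (rule measurableI)
    show "(t, \<omega>) \<in> space (predictable_sigma M F)" if "t \<in> space (restrict_space borel {0..})" for t
      using that \<omega> by (simp add: space_restrict_space)
    show "(\<lambda>t. (t, \<omega>)) -` S \<inter> space (restrict_space borel {0..}) \<in> sets (restrict_space borel {0..})"
      if "S \<in> sets (predictable_sigma M F)" for S
      using predictable_section[OF that \<omega>] by (auto simp: sets_restrict_space space_restrict_space)
  qed
  from measurable_compose[OF this f] show ?thesis
    by (subst (asm) borel_measurable_restrict_space_iff_ennreal) auto
qed

text \<open>Measurability and value are carried through one induction, because the sum and supremum
  steps exchange operations with the outer integral and need measurable inner integrals. The factor
  \<open>indicator {0..} t\<close> is there because \<open>f\<close> is unconstrained at negative
  times, outside the space of the predictable sigma-algebra.\<close>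

lemma nn_integral_doleans:
  assumes inc: "increasing_process M U"
    and meas: "\<And>t. 0 \<le> t \<Longrightarrow> U t \<in> borel_measurable M"
    and f: "f \<in> borel_measurable (predictable_sigma M F)"
  shows "(\<lambda>\<omega>. \<integral>\<^sup>+t. f (t, \<omega>) * indicator {0..} t \<partial>path_measure U \<omega>) \<in> borel_measurable M \<and>
    integral\<^sup>N (doleans U) f = (\<integral>\<^sup>+\<omega>. (\<integral>\<^sup>+t. f (t, \<omega>) * indicator {0..} t \<partial>path_measure U \<omega>) \<partial>M)"
  using f
proof (induction rule: borel_measurable_induct)
  case (cong f g)
  have "(\<integral>\<^sup>+t. f (t, \<omega>) * indicator {0..} t \<partial>path_measure U \<omega>)
      = (\<integral>\<^sup>+t. g (t, \<omega>) * indicator {0..} t \<partial>path_measure U \<omega>)" if "\<omega> \<in> space M" for \<omega>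
    using cong(3) that by (intro nn_integral_cong) (auto simp: indicator_def)
  moreover have "integral\<^sup>N (doleans U) f = integral\<^sup>N (doleans U) g"
    using cong(3) by (intro nn_integral_cong) auto
  ultimately show ?case
    using cong(4) by (simp cong: measurable_cong nn_integral_cong)
next
  case (set S)
  have "S \<subseteq> {0..} \<times> space M" using sets.sets_into_space[OF set] by simp
  then have "indicator S (t, \<omega>) * indicator {0..} t = (indicator ((\<lambda>t. (t, \<omega>)) -` S) t :: ennreal)"
    for t \<omega>
    by (auto simp: indicator_def)
  then have "(\<integral>\<^sup>+t. indicator S (t, \<omega>) * indicator {0..} t \<partial>path_measure U \<omega>)
      = emeasure (path_measure U \<omega>) ((\<lambda>t. (t, \<omega>)) -` S)" if "\<omega> \<in> space M" for \<omega>
    using predictable_section[OF set that] by simp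
  then show ?case
    using measurable_path_measure_section[OF inc meas set] emeasure_doleans[OF inc meas set] set
    by (simp cong: measurable_cong nn_integral_cong)
next
  case (mult u c)
  have "(\<integral>\<^sup>+t. (c * u (t, \<omega>)) * indicator {0..} t \<partial>path_measure U \<omega>)
      = c * (\<integral>\<^sup>+t. u (t, \<omega>) * indicator {0..} t \<partial>path_measure U \<omega>)" if "\<omega> \<in> space M" for \<omega>
    using measurable_section_function[OF mult(2) that]
    by (subst nn_integral_cmult[symmetric]) (auto simp: mult.assoc)
  moreover have "(\<lambda>\<omega>. c * (\<integral>\<^sup>+t. u (t, \<omega>) * indicator {0..} t \<partial>path_measure U \<omega>)) \<in> borel_measurable M"
    using mult by (intro borel_measurable_times_ennreal) auto
  ultimately show ?case
    using mult by (simp add: nn_integral_cmult cong: measurable_cong nn_integral_cong)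
next
  case (add u v)
  have "(\<integral>\<^sup>+t. (v (t, \<omega>) + u (t, \<omega>)) * indicator {0..} t \<partial>path_measure U \<omega>)
      = (\<integral>\<^sup>+t. v (t, \<omega>) * indicator {0..} t \<partial>path_measure U \<omega>)
      + (\<integral>\<^sup>+t. u (t, \<omega>) * indicator {0..} t \<partial>path_measure U \<omega>)" if "\<omega> \<in> space M" for \<omega>
    using measurable_section_function[OF add.hyps(1) that] measurable_section_function[OF add.hyps(3) that]
    by (subst nn_integral_add[symmetric]) (auto simp: distrib_right)
  moreover have "(\<lambda>\<omega>. (\<integral>\<^sup>+t. v (t, \<omega>) * indicator {0..} t \<partial>path_measure U \<omega>)
      + (\<integral>\<^sup>+t. u (t, \<omega>) * indicator {0..} t \<partial>path_measure U \<omega>)) \<in> borel_measurable M"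
    using add by (intro borel_measurable_add) auto
  ultimately show ?case
    using add by (simp add: nn_integral_add cong: measurable_cong nn_integral_cong)
next
  case (seq f)
  let ?I = "\<lambda>i \<omega>. \<integral>\<^sup>+t. f i (t, \<omega>) * indicator {0..} t \<partial>path_measure U \<omega>"
  have "(\<integral>\<^sup>+t. (SUP i. f i) (t, \<omega>) * indicator {0..} t \<partial>path_measure U \<omega>) = (SUP i. ?I i \<omega>)"
    if "\<omega> \<in> space M" for \<omega>
  proof -
    have "(\<integral>\<^sup>+t. (SUP i. f i) (t, \<omega>) * indicator {0..} t \<partial>path_measure U \<omega>)
      = (\<integral>\<^sup>+t. (SUP i. f i (t, \<omega>) * indicator {0..} t) \<partial>path_measure U \<omega>)"
      by (intro nn_integral_cong) (simp add: image_comp SUP_mult_right_ennreal)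
    also have "\<dots> = (SUP i. ?I i \<omega>)"
      using measurable_section_function[OF seq.hyps(1) that] seq.hyps(3)
      by (intro nn_integral_monotone_convergence_SUP)
        (auto simp: incseq_def le_fun_def intro!: mult_right_mono)
    finally show ?thesis .
  qed
  moreover have "incseq ?I"
    using seq.hyps(3) by (auto simp: incseq_def le_fun_def intro!: nn_integral_mono mult_right_mono)
  moreover have "integral\<^sup>N (doleans U) (SUP i. f i) = (SUP i. integral\<^sup>N (doleans U) (f i))"
  proof -
    have "f i \<in> borel_measurable (doleans U)" for i
      using seq.hyps(1)[of i] measurable_cong_sets[OF sets_doleans refl] by blast
    moreover have "(SUP i. f i) = (\<lambda>x. SUP i. f i x)"
      by (auto simp: fun_eq_iff image_comp)
    ultimately show ?thesis
      using nn_integral_monotone_convergence_SUP[OF seq.hyps(3)] by simp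
  qed
  moreover have "(\<lambda>\<omega>. SUP i. ?I i \<omega>) \<in> borel_measurable M"
    using seq.IH by (intro borel_measurable_SUP) auto
  ultimately show ?case
    using seq.IH by (simp add: nn_integral_monotone_convergence_SUP cong: measurable_cong nn_integral_cong)
qed

end

section \<open>Uniqueness of predictable increasing processes\<close>

text \<open>Tonelli on the square, cut into \<open>{y \<le> x}\<close> and \<open>{x < y}\<close>.
  The diagonal, which carries the common atoms, is counted once, in the first part; hence one ray is
  closed and the other open.\<close>

lemma nn_integral_by_parts:
  fixes \<mu> \<nu> :: "real measure"
  assumes "finite_measure \<mu>" "finite_measure \<nu>"
    and sets [measurable_cong]: "sets \<mu> = sets borel" "sets \<nu> = sets borel"
  shows "(\<lambda>s. emeasure \<nu> {..s}) \<in> borel_measurable borel"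
    and "(\<lambda>s. emeasure \<mu> {..<s}) \<in> borel_measurable borel"
    and "(\<integral>\<^sup>+s. emeasure \<nu> {..s} \<partial>\<mu>) + (\<integral>\<^sup>+s. emeasure \<mu> {..<s} \<partial>\<nu>)
      = emeasure \<mu> UNIV * emeasure \<nu> UNIV"
proof -
  interpret m: finite_measure \<mu> by fact
  interpret n: finite_measure \<nu> by fact
  interpret pair_sigma_finite \<mu> \<nu> ..
  have space: "space \<mu> = UNIV" "space \<nu> = UNIV"
    using sets_eq_imp_space_eq[OF sets(1)] sets_eq_imp_space_eq[OF sets(2)] by auto
  let ?A = "{x::real \<times> real. snd x \<le> fst x}" and ?B = "{x::real \<times> real. fst x < snd x}"
  have A: "?A \<in> sets (\<mu> \<Otimes>\<^sub>M \<nu>)" and B: "?B \<in> sets (\<mu> \<Otimes>\<^sub>M \<nu>)"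
  proof -
    have "{x \<in> space (borel \<Otimes>\<^sub>M borel). snd x \<le> fst x} \<in> sets (borel \<Otimes>\<^sub>M borel :: (real \<times> real) measure)"
      "{x \<in> space (borel \<Otimes>\<^sub>M borel). fst x < snd x} \<in> sets (borel \<Otimes>\<^sub>M borel :: (real \<times> real) measure)"
      by measurable
    then show "?A \<in> sets (\<mu> \<Otimes>\<^sub>M \<nu>)" "?B \<in> sets (\<mu> \<Otimes>\<^sub>M \<nu>)"
      unfolding sets_pair_measure_cong[OF sets] by (simp_all add: space_pair_measure)
  qed
  have sec: "Pair s -` ?A = {..s}" "(\<lambda>x. (x, s)) -` ?B = {..<s}" for s :: real
    by auto
  show "(\<lambda>s. emeasure \<nu> {..s}) \<in> borel_measurable borel"
    using n.measurable_emeasure_Pair[OF A] unfolding sec measurable_cong_sets[OF sets(1) refl] .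
  show "(\<lambda>s. emeasure \<mu> {..<s}) \<in> borel_measurable borel"
    using measurable_emeasure_Pair2[OF B] unfolding sec measurable_cong_sets[OF sets(2) refl] .
  have "(\<integral>\<^sup>+s. emeasure \<nu> {..s} \<partial>\<mu>) + (\<integral>\<^sup>+s. emeasure \<mu> {..<s} \<partial>\<nu>)
      = emeasure (\<mu> \<Otimes>\<^sub>M \<nu>) ?A + emeasure (\<mu> \<Otimes>\<^sub>M \<nu>) ?B"
    unfolding n.emeasure_pair_measure_alt[OF A] emeasure_pair_measure_alt2[OF B] sec ..
  also have "\<dots> = emeasure (\<mu> \<Otimes>\<^sub>M \<nu>) (?A \<union> ?B)"
    using A B by (intro plus_emeasure) auto
  also have "?A \<union> ?B = UNIV \<times> UNIV" by auto
  also have "emeasure (\<mu> \<Otimes>\<^sub>M \<nu>) (UNIV \<times> UNIV) = emeasure \<mu> UNIV * emeasure \<nu> UNIV"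
    by (intro n.emeasure_pair_measure_Times) (simp_all add: sets)
  finally show "(\<integral>\<^sup>+s. emeasure \<nu> {..s} \<partial>\<mu>) + (\<integral>\<^sup>+s. emeasure \<mu> {..<s} \<partial>\<nu>)
      = emeasure \<mu> UNIV * emeasure \<nu> UNIV" .
qed

text \<open>Both path measures are restricted to \<open>k\<close> by a density, which makes them
  finite. Downward closedness is what turns the mass of \<open>{..s} \<inter> k\<close> into the
  full value \<open>V s \<omega>\<close> and that of \<open>{..<s} \<inter> k\<close> into the left
  limit of \<open>U\<close>.\<close>

lemma path_measure_by_parts:
  assumes U: "increasing_process M U" and V: "increasing_process M V" and \<omega>: "\<omega> \<in> space M"
    and k: "k \<in> sets borel" "k \<subseteq> {0..q}" and down: "\<And>t. t \<in> k \<Longrightarrow> {0..t} \<subseteq> k"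
  shows "(\<integral>\<^sup>+s. ennreal (V s \<omega>) * indicator k s \<partial>path_measure U \<omega>)
      + (\<integral>\<^sup>+s. emeasure (path_measure U \<omega>) {0..<s} * indicator k s \<partial>path_measure V \<omega>)
      = emeasure (path_measure U \<omega>) k * emeasure (path_measure V \<omega>) k"
proof (cases "k = {}")
  case False
  then have q: "0 \<le> q" using k(2) by auto
  let ?\<mu> = "density (path_measure U \<omega>) (indicator k)" and ?\<nu> = "density (path_measure V \<omega>) (indicator k)"
  have dens: "emeasure (density (path_measure W \<omega>) (indicator k)) A = emeasure (path_measure W \<omega>) (A \<inter> k)"
    if "A \<in> sets borel" for A W
    using that k by (subst emeasure_density) (auto simp: indicator_inter_arith[symmetric] Int_commute)
  have fin: "finite_measure (density (path_measure W \<omega>) (indicator k))" if W: "increasing_process M W" for W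
  proof (rule finite_measureI)
    have "emeasure (path_measure W \<omega>) k \<le> emeasure (path_measure W \<omega>) {0..q}"
      using k by (intro emeasure_mono) auto
    also have "\<dots> < \<infinity>"
      using path_measure_atLeastAtMost[OF W \<omega> q] by simp
    finally show "emeasure (density (path_measure W \<omega>) (indicator k))
        (space (density (path_measure W \<omega>) (indicator k))) \<noteq> \<infinity>"
      using dens[of UNIV W] by simp
  qed
  note parts = nn_integral_by_parts[OF fin[OF U] fin[OF V]]
  have Int: "{..s} \<inter> k = {0..s}" "{..<s} \<inter> k = {0..<s}" if "s \<in> k" for s
    using down[OF that] k(2) by auto
  have "(\<integral>\<^sup>+s. emeasure ?\<nu> {..s} \<partial>?\<mu>)
      = (\<integral>\<^sup>+s. ennreal (V s \<omega>) * indicator k s \<partial>path_measure U \<omega>)"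
  proof -
    have "(\<integral>\<^sup>+s. emeasure ?\<nu> {..s} \<partial>?\<mu>)
        = (\<integral>\<^sup>+s. indicator k s * emeasure ?\<nu> {..s} \<partial>path_measure U \<omega>)"
      using parts(1) k(1) by (intro nn_integral_density) auto
    also have "\<dots> = (\<integral>\<^sup>+s. ennreal (V s \<omega>) * indicator k s \<partial>path_measure U \<omega>)"
    proof (rule nn_integral_cong)
      fix s
      have "0 \<le> s" if "s \<in> k" using k(2) that by auto
      then show "indicator k s * emeasure ?\<nu> {..s} = ennreal (V s \<omega>) * indicator k s"
        using path_measure_atLeastAtMost[OF V \<omega>, of s] by (cases "s \<in> k") (auto simp: dens Int)
    qed
    finally show ?thesis .
  qed
  moreover have "(\<integral>\<^sup>+s. emeasure ?\<mu> {..<s} \<partial>?\<nu>)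
      = (\<integral>\<^sup>+s. emeasure (path_measure U \<omega>) {0..<s} * indicator k s \<partial>path_measure V \<omega>)"
  proof -
    have "(\<integral>\<^sup>+s. emeasure ?\<mu> {..<s} \<partial>?\<nu>)
        = (\<integral>\<^sup>+s. indicator k s * emeasure ?\<mu> {..<s} \<partial>path_measure V \<omega>)"
      using parts(2) k(1) by (intro nn_integral_density) auto
    also have "\<dots> = (\<integral>\<^sup>+s. emeasure (path_measure U \<omega>) {0..<s} * indicator k s \<partial>path_measure V \<omega>)"
    proof (rule nn_integral_cong)
      fix s
      show "indicator k s * emeasure ?\<mu> {..<s} = emeasure (path_measure U \<omega>) {0..<s} * indicator k s"
        by (cases "s \<in> k") (auto simp: dens Int)
    qed
    finally show ?thesis .
  qed
  ultimately show ?thesis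
    using parts(3) dens[of UNIV] by simp
qed simp

text \<open>For \<open>t > 0\<close> the mass of \<open>{0..<t}\<close> is the left limit of the
  path at \<open>t\<close>. Describing it through rational earlier times makes its superlevel sets
  countable unions, and it also transfers bounds from earlier values to the left limit.\<close>

lemma path_measure_atLeastLessThan_gt:
  assumes U: "increasing_process M U" and \<omega>: "\<omega> \<in> space M"
  shows "y < emeasure (path_measure U \<omega>) {0..<t} \<longleftrightarrow> (\<exists>r\<in>\<rat>. 0 \<le> r \<and> r < t \<and> y < ennreal (U r \<omega>))"
proof
  assume y: "y < emeasure (path_measure U \<omega>) {0..<t}"
  have "{0..<t} = (\<Union>n. {0..t - 1 / real (Suc n)})"
  proof (intro set_eqI iffI)
    fix x assume x: "x \<in> {0..<t}"
    then obtain n where "inverse (real (Suc n)) < t - x"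
      using reals_Archimedean[of "t - x"] by auto
    then show "x \<in> (\<Union>n. {0..t - 1 / real (Suc n)})"
      using x by (intro UN_I[of n]) (auto simp: inverse_eq_divide)
  next
    fix x assume "x \<in> (\<Union>n. {0..t - 1 / real (Suc n)})"
    then obtain n where "0 \<le> x" "x \<le> t - 1 / real (Suc n)" by auto
    moreover have "0 < 1 / real (Suc n)" by simp
    ultimately have "x < t" by linarith
    with \<open>0 \<le> x\<close> show "x \<in> {0..<t}" by simp
  qed
  moreover have "incseq (\<lambda>n. {0..t - 1 / real (Suc n)})"
  proof (rule incseq_SucI)
    fix n
    have "1 / real (Suc (Suc n)) \<le> 1 / real (Suc n)" by (simp add: field_simps)
    then show "{0..t - 1 / real (Suc n)} \<le> {0..t - 1 / real (Suc (Suc n))}"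
      by (auto simp del: of_nat_Suc)
  qed
  ultimately have "emeasure (path_measure U \<omega>) {0..<t}
      = (SUP n. emeasure (path_measure U \<omega>) {0..t - 1 / real (Suc n)})"
    by (simp only:) (intro SUP_emeasure_incseq[symmetric], auto)
  with y obtain n where n: "y < emeasure (path_measure U \<omega>) {0..t - 1 / real (Suc n)}"
    by (auto simp: less_SUP_iff)
  \<comment> \<open>With a negative right endpoint the interval would be empty and have mass zero,
    which cannot exceed \<open>y\<close>.\<close>
  then have "0 \<le> t - 1 / real (Suc n)"
    by (cases "0 \<le> t - 1 / real (Suc n)") (simp_all del: of_nat_Suc)
  moreover have "t - 1 / real (Suc n) < t" by simp
  then obtain r where r: "r \<in> \<rat>" "t - 1 / real (Suc n) < r" "r < t"
    using Rats_dense_in_real by blast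
  moreover have "emeasure (path_measure U \<omega>) {0..t - 1 / real (Suc n)} \<le> emeasure (path_measure U \<omega>) {0..r}"
    using r by (intro emeasure_mono) auto
  ultimately show "\<exists>r\<in>\<rat>. 0 \<le> r \<and> r < t \<and> y < ennreal (U r \<omega>)"
    using path_measure_atLeastAtMost[OF U \<omega>, of r] n by (intro bexI[of _ r]) auto
next
  assume "\<exists>r\<in>\<rat>. 0 \<le> r \<and> r < t \<and> y < ennreal (U r \<omega>)"
  then obtain r where r: "0 \<le> r" "r < t" "y < ennreal (U r \<omega>)" by auto
  have "emeasure (path_measure U \<omega>) {0..r} \<le> emeasure (path_measure U \<omega>) {0..<t}"
    using r by (intro emeasure_mono) auto
  then show "y < emeasure (path_measure U \<omega>) {0..<t}"
    using r path_measure_atLeastAtMost[OF U \<omega>, of r] by auto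
qed

section \<open>Predictability of left limits\<close>

context usual_filtration
begin

lemma ray_predictable:
  assumes "0 \<le> r" "A \<in> sets (F r)"
  shows "{r<..} \<times> A \<in> sets (predictable_sigma M F)"
proof -
  have "{r<..} \<times> A = (\<Union>n. {r<..r + real n} \<times> A)"
  proof (intro set_eqI iffI)
    fix x assume x: "x \<in> {r<..} \<times> A"
    obtain n where "fst x - r \<le> real n" using real_arch_simple by blast
    then show "x \<in> (\<Union>n. {r<..r + real n} \<times> A)"
      using x by (intro UN_I[of n]) auto
  qed auto
  moreover have "{r<..r + real n} \<times> A \<in> sets (predictable_sigma M F)" for n
    unfolding sets_predictable_sigma using assms
    by (intro sigma_sets.Basic Ioc_rectangle) auto
  ultimately show ?thesis by auto
qed

text \<open>The left limit at \<open>t\<close> exceeds \<open>y\<close> once some earlier rational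
  value does. Each superlevel set is therefore a countable union of rays
  \<open>{r<..} \<times> A\<close> with \<open>A\<close> in \<open>F r\<close>, which are
  predictable because they start strictly after \<open>r\<close>.\<close>

lemma left_process_predictable:
  assumes U: "increasing_process M U" "predictable_process M F U"
  shows "(\<lambda>(t, \<omega>). emeasure (path_measure U \<omega>) {0..<t}) \<in> borel_measurable (predictable_sigma M F)"
proof (rule borel_measurableI_greater)
  fix y :: ennreal
  have "{x \<in> space (predictable_sigma M F). y < (\<lambda>(t, \<omega>). emeasure (path_measure U \<omega>) {0..<t}) x}
      = (\<Union>r\<in>\<rat> \<inter> {0..}. {r<..} \<times> {\<omega> \<in> space (F r). y < ennreal (U r \<omega>)})"
  proof (intro set_eqI)
    fix x :: "real \<times> 'a"
    obtain t \<omega> where x: "x = (t, \<omega>)" by (cases x)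
    show "x \<in> {x \<in> space (predictable_sigma M F). y < (\<lambda>(t, \<omega>). emeasure (path_measure U \<omega>) {0..<t}) x}
      \<longleftrightarrow> x \<in> (\<Union>r\<in>\<rat> \<inter> {0..}. {r<..} \<times> {\<omega> \<in> space (F r). y < ennreal (U r \<omega>)})"
    proof (cases "\<omega> \<in> space M")
      case True
      then show ?thesis
        using path_measure_atLeastLessThan_gt[OF U(1) True, of y t]
        by (auto simp: x space_F intro: less_imp_le order_le_less_trans)
    qed (auto simp: x space_F)
  qed
  moreover have "{\<omega> \<in> space (F r). y < ennreal (U r \<omega>)} \<in> sets (F r)" if "0 \<le> r" for r
    using predictable_process_measurable[OF U(2) that] by measurable
  then have "(\<Union>r\<in>\<rat> \<inter> {0..}. {r<..} \<times> {\<omega> \<in> space (F r). y < ennreal (U r \<omega>)}) \<in> sets (predictable_sigma M F)"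
    by (intro sets.countable_UN'' countable_Int1 countable_rat ray_predictable) simp_all
  ultimately show "{x \<in> space (predictable_sigma M F). y < (\<lambda>(t, \<omega>). emeasure (path_measure U \<omega>) {0..<t}) x}
      \<in> sets (predictable_sigma M F)"
    by simp
qed

end

lemma increasing_process_right_cont:
  "increasing_process M U \<Longrightarrow> \<omega> \<in> space M \<Longrightarrow> 0 \<le> t \<Longrightarrow> ((\<lambda>s. U s \<omega>) \<longlongrightarrow> U t \<omega>) (at_right t)"
  by (auto simp: increasing_process_def continuous_within)

context usual_filtration
begin

lemma process_time_predictable: "{x \<in> {0..} \<times> space M. fst x \<le> q} \<in> sets (predictable_sigma M F)"
proof (cases "0 \<le> q")
  case True
  then have "{x \<in> {0..} \<times> space M. fst x \<le> q} = {0..} \<times> space M - {q<..} \<times> space M"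
    by auto
  moreover have "{q<..} \<times> space M \<in> sets (predictable_sigma M F)"
    using ray_predictable[OF True sets.top] True by (simp add: space_F)
  ultimately show ?thesis
    using sets.compl_sets[of "{q<..} \<times> space M" "predictable_sigma M F"] by simp
next
  case False
  then have "{x \<in> {0..} \<times> space M. fst x \<le> q} = {}" by auto
  then show ?thesis by (simp only:) simp
qed

text \<open>The expected product on the left is not an integral against a Doleans measure. After
  integration by parts both integrands are predictable, so the right-hand side sees the two
  integrators only through their Doleans measures, and these can be exchanged when they
  agree.\<close>

lemma doleans_by_parts:
  assumes U: "increasing_process M U" "predictable_process M F U"
    and V: "increasing_process M V" "predictable_process M F V"
    and K: "K \<in> sets (predictable_sigma M F)" "K \<subseteq> {0..q} \<times> space M"
    and down: "\<And>t \<omega>. t \<in> (\<lambda>t. (t, \<omega>)) -` K \<Longrightarrow> {0..t} \<subseteq> (\<lambda>t. (t, \<omega>)) -` K"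
  shows "(\<integral>\<^sup>+\<omega>. emeasure (path_measure U \<omega>) ((\<lambda>t. (t, \<omega>)) -` K)
          * emeasure (path_measure V \<omega>) ((\<lambda>t. (t, \<omega>)) -` K) \<partial>M)
    = (\<integral>\<^sup>+(t, \<omega>). ennreal (V t \<omega>) * indicator K (t, \<omega>) \<partial>doleans U)
    + (\<integral>\<^sup>+(t, \<omega>). emeasure (path_measure U \<omega>) {0..<t} * indicator K (t, \<omega>) \<partial>doleans V)"
proof -
  let ?k = "\<lambda>\<omega>. (\<lambda>t. (t, \<omega>)) -` K"
  let ?f = "\<lambda>(t, \<omega>). ennreal (V t \<omega>) * indicator K (t, \<omega>)"
  let ?g = "\<lambda>(t, \<omega>). emeasure (path_measure U \<omega>) {0..<t} * indicator K (t, \<omega>)"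
  have f: "?f \<in> borel_measurable (predictable_sigma M F)"
  proof -
    have "(\<lambda>x. ennreal ((\<lambda>(t, \<omega>). V t \<omega>) x) * indicator K x) \<in> borel_measurable (predictable_sigma M F)"
      using V(2) K(1) unfolding predictable_process_def by (intro borel_measurable_times_ennreal) auto
    then show ?thesis by (simp add: case_prod_beta')
  qed
  have g: "?g \<in> borel_measurable (predictable_sigma M F)"
  proof -
    have "(\<lambda>x. (\<lambda>(t, \<omega>). emeasure (path_measure U \<omega>) {0..<t}) x * indicator K x)
        \<in> borel_measurable (predictable_sigma M F)"
      using left_process_predictable[OF U] K(1) by (intro borel_measurable_times_ennreal) auto
    then show ?thesis by (simp add: case_prod_beta')
  qed
  have ind: "x * indicator K (t, \<omega>) * indicator {0..} t = x * indicator (?k \<omega>) t" for x :: ennreal and t \<omega>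
    using K(2) by (auto simp: indicator_def)
  have "emeasure (path_measure U \<omega>) (?k \<omega>) * emeasure (path_measure V \<omega>) (?k \<omega>)
      = (\<integral>\<^sup>+t. ?f (t, \<omega>) * indicator {0..} t \<partial>path_measure U \<omega>)
      + (\<integral>\<^sup>+t. ?g (t, \<omega>) * indicator {0..} t \<partial>path_measure V \<omega>)" if "\<omega> \<in> space M" for \<omega>
  proof -
    have "?k \<omega> \<subseteq> {0..q}"
      using K(2) by auto
    from path_measure_by_parts[OF U(1) V(1) that predictable_section[OF K(1) that] this down]
    show ?thesis by (simp add: ind)
  qed
  then show ?thesis
    using nn_integral_doleans[OF U(1) predictable_process_measurable_M[OF U(2)] f] nn_integral_doleans[OF V(1) predictable_process_measurable_M[OF V(2)] g]
    by (simp add: nn_integral_add cong: nn_integral_cong)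
qed

text \<open>A nonempty bounded downward closed set of times is \<open>{0..T}\<close> or
  \<open>{0..<T}\<close>, so its mass is a value or a left limit of the path, and either is at most
  \<open>n\<close>. The half-open form arises when the path jumps across the level at
  \<open>T\<close>.\<close>

lemma path_measure_down_set_le:
  assumes U: "increasing_process M U" and \<omega>: "\<omega> \<in> space M"
    and k: "k \<subseteq> {0..q}" and down: "\<And>t. t \<in> k \<Longrightarrow> {0..t} \<subseteq> k"
    and bound: "\<And>t. t \<in> k \<Longrightarrow> U t \<omega> \<le> n"
  shows "emeasure (path_measure U \<omega>) k \<le> ennreal n"
proof (cases "k = {}")
  case False
  have bdd: "bdd_above k" by (rule bdd_above_mono[OF bdd_above_Icc k])
  define T where "T = Sup k"
  have T: "t \<le> T" if "t \<in> k" for t using that bdd by (simp add: T_def cSup_upper)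
  show ?thesis
  proof (cases "T \<in> k")
    case True
    then have "k = {0..T}" using T k down[OF True] by (intro antisym) auto
    with True show ?thesis
      using path_measure_atLeastAtMost[OF U \<omega>, of T] bound[OF True] by (simp add: ennreal_leI)
  next
    case False
    have k_eq: "k = {0..<T}"
    proof (intro set_eqI iffI)
      fix x assume "x \<in> {0..<T}"
      then obtain y where "y \<in> k" "x < y"
        using less_cSup_iff[OF \<open>k \<noteq> {}\<close> bdd] by (auto simp: T_def)
      then show "x \<in> k" using down[of y] \<open>x \<in> {0..<T}\<close> by auto
    next
      fix x assume "x \<in> k"
      then show "x \<in> {0..<T}" using T[of x] k False by (cases "x = T") auto
    qed
    show ?thesis
    proof (rule ccontr)
      assume "\<not> ?thesis"
      then obtain r where "0 \<le> r" "r < T" "ennreal n < ennreal (U r \<omega>)"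
        using path_measure_atLeastLessThan_gt[OF U \<omega>, of "ennreal n" T] by (auto simp: k_eq not_le)
      moreover from this have "r \<in> k" by (simp add: k_eq)
      ultimately show False using bound[of r] by (simp add: ennreal_leI leD)
    qed
  qed
qed simp

text \<open>The equation states that the mean square of \<open>a - c\<close> vanishes, with cross
  terms kept on the other side to avoid subtraction. Boundedness on a finite measure space makes the
  cross terms finite, so that they may be cancelled.\<close>

lemma AE_eq_of_square:
  assumes [measurable]: "a \<in> borel_measurable M" "c \<in> borel_measurable M"
    and fin: "finite_measure M"
    and bound: "\<And>\<omega>. \<omega> \<in> space M \<Longrightarrow> a \<omega> \<le> ennreal n" "\<And>\<omega>. \<omega> \<in> space M \<Longrightarrow> c \<omega> \<le> ennreal n"
    and eq: "(\<integral>\<^sup>+\<omega>. a \<omega> * a \<omega> \<partial>M) + (\<integral>\<^sup>+\<omega>. c \<omega> * c \<omega> \<partial>M)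
      = (\<integral>\<^sup>+\<omega>. a \<omega> * c \<omega> \<partial>M) + (\<integral>\<^sup>+\<omega>. c \<omega> * a \<omega> \<partial>M)"
  shows "AE \<omega> in M. a \<omega> = c \<omega>"
proof -
  interpret finite_measure M by fact
  have a: "ennreal (enn2real (a \<omega>)) = a \<omega>" and c: "ennreal (enn2real (c \<omega>)) = c \<omega>" if "\<omega> \<in> space M" for \<omega>
    using bound[OF that] by (auto simp: ennreal_enn2real_if top_unique)
  \<comment> \<open>Subtraction of extended nonnegative reals truncates at zero, so the difference
    is formed among the reals before squaring.\<close>
  let ?d = "\<lambda>\<omega>. ennreal ((enn2real (a \<omega>) - enn2real (c \<omega>))\<^sup>2)"
  have "?d \<omega> + (a \<omega> * c \<omega> + c \<omega> * a \<omega>) = a \<omega> * a \<omega> + c \<omega> * c \<omega>" if "\<omega> \<in> space M" for \<omega>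
  proof -
    define x y where "x = enn2real (a \<omega>)" and "y = enn2real (c \<omega>)"
    have "a \<omega> = ennreal x" "c \<omega> = ennreal y" "0 \<le> x" "0 \<le> y"
      using a c that by (auto simp: x_def y_def)
    have d: "?d \<omega> = ennreal ((x - y)\<^sup>2)"
      by (simp add: x_def y_def)
    have "?d \<omega> + (a \<omega> * c \<omega> + c \<omega> * a \<omega>) = ennreal ((x - y)\<^sup>2 + (x * y + y * x))"
      unfolding d unfolding \<open>a \<omega> = ennreal x\<close> \<open>c \<omega> = ennreal y\<close> using \<open>0 \<le> x\<close> \<open>0 \<le> y\<close>
      by (simp only: ennreal_mult ennreal_plus mult_nonneg_nonneg add_nonneg_nonneg zero_le_power2)
    also have "(x - y)\<^sup>2 + (x * y + y * x) = x * x + y * y"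
      by (simp add: power2_eq_square algebra_simps)
    also have "ennreal (x * x + y * y) = a \<omega> * a \<omega> + c \<omega> * c \<omega>"
      using \<open>a \<omega> = ennreal x\<close> \<open>c \<omega> = ennreal y\<close> \<open>0 \<le> x\<close> \<open>0 \<le> y\<close> by (simp add: ennreal_mult)
    finally show ?thesis .
  qed
  then have "(\<integral>\<^sup>+\<omega>. ?d \<omega> + (a \<omega> * c \<omega> + c \<omega> * a \<omega>) \<partial>M) = (\<integral>\<^sup>+\<omega>. a \<omega> * a \<omega> + c \<omega> * c \<omega> \<partial>M)"
    by (rule nn_integral_cong)
  then have "(\<integral>\<^sup>+\<omega>. ?d \<omega> \<partial>M) + (\<integral>\<^sup>+\<omega>. a \<omega> * c \<omega> + c \<omega> * a \<omega> \<partial>M) = (\<integral>\<^sup>+\<omega>. a \<omega> * c \<omega> + c \<omega> * a \<omega> \<partial>M)"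
    using eq by (simp add: nn_integral_add)
  moreover have "(\<integral>\<^sup>+\<omega>. a \<omega> * c \<omega> + c \<omega> * a \<omega> \<partial>M) < \<infinity>"
  proof -
    have "(\<integral>\<^sup>+\<omega>. a \<omega> * c \<omega> + c \<omega> * a \<omega> \<partial>M) \<le> (\<integral>\<^sup>+\<omega>. ennreal n * ennreal n + ennreal n * ennreal n \<partial>M)"
      using bound by (intro nn_integral_mono add_mono mult_mono) auto
    also have "\<dots> < \<infinity>"
      by (simp add: ennreal_mult_eq_top_iff less_top[symmetric])
    finally show ?thesis .
  qed
  ultimately have "(\<integral>\<^sup>+\<omega>. ?d \<omega> \<partial>M) = 0"
    using ennreal_add_diff_cancel_right[of "\<integral>\<^sup>+\<omega>. a \<omega> * c \<omega> + c \<omega> * a \<omega> \<partial>M" "\<integral>\<^sup>+\<omega>. ?d \<omega> \<partial>M"]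
    by auto
  then have "AE \<omega> in M. ?d \<omega> = 0"
    by (subst (asm) nn_integral_0_iff_AE) measurable
  then show ?thesis
  proof (rule AE_mp, intro AE_I2 impI)
    fix \<omega> assume "\<omega> \<in> space M" "?d \<omega> = 0"
    then have "enn2real (a \<omega>) = enn2real (c \<omega>)" by (simp add: ennreal_eq_0_iff)
    with a[OF \<open>\<omega> \<in> space M\<close>] c[OF \<open>\<omega> \<in> space M\<close>] show "a \<omega> = c \<omega>" by metis
  qed
qed

lemma doleans_unique:
  assumes fin: "finite_measure M"
    and U: "increasing_process M U" "predictable_process M F U"
    and V: "increasing_process M V" "predictable_process M F V"
    and eq: "doleans U = doleans V"
  shows "AE \<omega> in M. \<forall>t\<ge>0. U t \<omega> = V t \<omega>"
proof -
  \<comment> \<open>The level \<open>n\<close> bounds both paths and \<open>q\<close> bounds time.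
    As \<open>U\<close> and \<open>V\<close> are monotone, each section is downward closed.\<close>
  define K where "K n q = {(t, \<omega>). 0 \<le> t \<and> \<omega> \<in> space M \<and> t \<le> q \<and> U t \<omega> + V t \<omega> \<le> real n}" for n :: nat and q :: real
  have K: "K n q \<in> sets (predictable_sigma M F)" "K n q \<subseteq> {0..q} \<times> space M" for n q
  proof -
    have [measurable]: "(\<lambda>x. U (fst x) (snd x)) \<in> borel_measurable (predictable_sigma M F)"
       "(\<lambda>x. V (fst x) (snd x)) \<in> borel_measurable (predictable_sigma M F)"
      using U(2) V(2) by (simp_all add: predictable_process_def case_prod_beta')
    have "{x \<in> space (predictable_sigma M F). U (fst x) (snd x) + V (fst x) (snd x) \<le> real n}
        \<in> sets (predictable_sigma M F)"
      by measurable
    moreover have "K n q = {x \<in> {0..} \<times> space M. fst x \<le> q} \<inter>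
        {x \<in> space (predictable_sigma M F). U (fst x) (snd x) + V (fst x) (snd x) \<le> real n}"
      by (auto simp: K_def)
    ultimately show "K n q \<in> sets (predictable_sigma M F)"
      using process_time_predictable by simp
    show "K n q \<subseteq> {0..q} \<times> space M" by (auto simp: K_def)
  qed
  have down: "{0..t} \<subseteq> (\<lambda>t. (t, \<omega>)) -` K n q" if t: "t \<in> (\<lambda>t. (t, \<omega>)) -` K n q" for t \<omega> n q
  proof
    fix s assume s: "s \<in> {0..t}"
    have "U s \<omega> \<le> U t \<omega>" "V s \<omega> \<le> V t \<omega>"
      using s t U(1) V(1) by (auto simp: K_def increasing_process_def)
    then show "s \<in> (\<lambda>t. (t, \<omega>)) -` K n q" using s t by (auto simp: K_def)
  qed
  let ?k = "\<lambda>n q \<omega>. (\<lambda>t. (t, \<omega>)) -` K n q"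
  have nonneg: "0 \<le> W t \<omega>" if "increasing_process M W" "\<omega> \<in> space M" "0 \<le> t" for W t \<omega>
  proof -
    have "0 \<le> W 0 \<omega>" "W 0 \<omega> \<le> W t \<omega>" using that by (auto simp: increasing_process_def)
    then show ?thesis by linarith
  qed
  have "AE \<omega> in M. emeasure (path_measure U \<omega>) (?k n q \<omega>) = emeasure (path_measure V \<omega>) (?k n q \<omega>)" for n q
  proof (rule AE_eq_of_square[OF _ _ fin, where n = "real n"])
    show "(\<lambda>\<omega>. emeasure (path_measure U \<omega>) (?k n q \<omega>)) \<in> borel_measurable M"
      "(\<lambda>\<omega>. emeasure (path_measure V \<omega>) (?k n q \<omega>)) \<in> borel_measurable M"
      using measurable_path_measure_section[OF U(1) predictable_process_measurable_M[OF U(2)] K(1)]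
        measurable_path_measure_section[OF V(1) predictable_process_measurable_M[OF V(2)] K(1)] by auto
    fix \<omega> assume \<omega>: "\<omega> \<in> space M"
    have k: "?k n q \<omega> \<subseteq> {0..q}"
      by (auto simp: K_def)
    have "U t \<omega> \<le> real n" "V t \<omega> \<le> real n" if "t \<in> ?k n q \<omega>" for t
      using that nonneg[OF U(1) \<omega>, of t] nonneg[OF V(1) \<omega>, of t] by (auto simp: K_def)
    then show "emeasure (path_measure U \<omega>) (?k n q \<omega>) \<le> ennreal (real n)"
      "emeasure (path_measure V \<omega>) (?k n q \<omega>) \<le> ennreal (real n)"
      using path_measure_down_set_le[OF U(1) \<omega> k down] path_measure_down_set_le[OF V(1) \<omega> k down] by blast+
  next
    have parts: "(\<integral>\<^sup>+\<omega>. emeasure (path_measure U \<omega>) (?k n q \<omega>) * emeasure (path_measure V \<omega>) (?k n q \<omega>) \<partial>M)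
      = (\<integral>\<^sup>+(t, \<omega>). ennreal (V t \<omega>) * indicator (K n q) (t, \<omega>) \<partial>doleans U)
      + (\<integral>\<^sup>+(t, \<omega>). emeasure (path_measure U \<omega>) {0..<t} * indicator (K n q) (t, \<omega>) \<partial>doleans V)"
      if "increasing_process M U" "predictable_process M F U"
        "increasing_process M V" "predictable_process M F V" for U V
      by (rule doleans_by_parts[OF that K down])
    show "(\<integral>\<^sup>+\<omega>. emeasure (path_measure U \<omega>) (?k n q \<omega>) * emeasure (path_measure U \<omega>) (?k n q \<omega>) \<partial>M)
      + (\<integral>\<^sup>+\<omega>. emeasure (path_measure V \<omega>) (?k n q \<omega>) * emeasure (path_measure V \<omega>) (?k n q \<omega>) \<partial>M)
      = (\<integral>\<^sup>+\<omega>. emeasure (path_measure U \<omega>) (?k n q \<omega>) * emeasure (path_measure V \<omega>) (?k n q \<omega>) \<partial>M)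
      + (\<integral>\<^sup>+\<omega>. emeasure (path_measure V \<omega>) (?k n q \<omega>) * emeasure (path_measure U \<omega>) (?k n q \<omega>) \<partial>M)"
      \<comment> \<open>Once the two Doleans measures are identified, both sides are sums of the
        same four integrals: those of \<open>U\<close>, \<open>V\<close> and their left limits over
        \<open>K n q\<close>. The mixed products merely pair them differently.\<close>
      unfolding parts[OF U U] parts[OF V V] parts[OF U V] parts[OF V U] eq by (simp add: ac_simps)
  qed
  then have "AE \<omega> in M. \<forall>n. \<forall>q\<in>\<rat>. emeasure (path_measure U \<omega>) (?k n q \<omega>) = emeasure (path_measure V \<omega>) (?k n q \<omega>)"
    by (subst AE_all_countable, intro allI, subst AE_ball_countable[OF countable_rat]) auto
  then show ?thesis
  proof (rule AE_mp, intro AE_I2 impI allI)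
    fix \<omega> and t :: real
    assume \<omega>: "\<omega> \<in> space M" and t: "0 \<le> t"
      and k: "\<forall>n. \<forall>q\<in>\<rat>. emeasure (path_measure U \<omega>) (?k n q \<omega>) = emeasure (path_measure V \<omega>) (?k n q \<omega>)"
    have rat: "U q \<omega> = V q \<omega>" if q: "q \<in> \<rat>" "0 \<le> q" for q
    proof -
      \<comment> \<open>A level above the value at \<open>q\<close> makes localisation invisible up
        to time \<open>q\<close>: the section is all of \<open>{0..q}\<close>, and its masses are
        the values of the two paths.\<close>
      obtain n where n: "U q \<omega> + V q \<omega> \<le> real n" using real_arch_simple by blast
      have "?k n q \<omega> = {0..q}"
        using n q \<omega> down[of q \<omega> n q] by (auto simp: K_def)
      moreover have "emeasure (path_measure U \<omega>) (?k n q \<omega>) = emeasure (path_measure V \<omega>) (?k n q \<omega>)"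
        using k q(1) by blast
      ultimately have "ennreal (U q \<omega>) = ennreal (V q \<omega>)"
        using path_measure_atLeastAtMost[OF U(1) \<omega> q(2)] path_measure_atLeastAtMost[OF V(1) \<omega> q(2)]
        by simp
      then show ?thesis
        using nonneg[OF U(1) \<omega> q(2)] nonneg[OF V(1) \<omega> q(2)] by simp
    qed
    \<comment> \<open>Right-continuity carries agreement from rational times to \<open>t\<close>: a
      nonzero difference at \<open>t\<close> would persist on a right neighbourhood, which contains
      a rational.\<close>
    have lim: "((\<lambda>s. U s \<omega> - V s \<omega>) \<longlongrightarrow> U t \<omega> - V t \<omega>) (at_right t)"
      by (intro tendsto_diff increasing_process_right_cont[OF U(1) \<omega> t] increasing_process_right_cont[OF V(1) \<omega> t])
    have "U t \<omega> - V t \<omega> = 0"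
    proof (rule ccontr)
      assume "U t \<omega> - V t \<omega> \<noteq> 0"
      with lim have "\<forall>\<^sub>F s in at_right t. U s \<omega> - V s \<omega> \<noteq> 0"
        by (rule tendsto_imp_eventually_ne)
      then obtain d where d: "t < d" "\<And>s. t < s \<Longrightarrow> s < d \<Longrightarrow> U s \<omega> - V s \<omega> \<noteq> 0"
        unfolding eventually_at_right_field by blast
      then obtain q where "q \<in> \<rat>" "t < q" "q < d" using Rats_dense_in_real by blast
      with rat[of q] t d(2)[of q] show False by simp
    qed
    then show "U t \<omega> = V t \<omega>" by simp
  qed
qed
end

section \<open>Compensators of counting processes\<close>

lemma count_proc_increasing: "increasing_process M (count_proc \<sigma>)"
  unfolding increasing_process_def
proof (intro ballI conjI allI impI)
  fix \<omega> and s t :: real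
  show "0 \<le> count_proc \<sigma> 0 \<omega>" by (simp add: count_proc_def)
  show "count_proc \<sigma> s \<omega> \<le> count_proc \<sigma> t \<omega>" if "0 \<le> s \<and> s \<le> t"
    using that order_trans[of "\<sigma> \<omega>" "ereal s" "ereal t"] by (auto simp: count_proc_def)
  have "\<forall>\<^sub>F s in at_right t. count_proc \<sigma> s \<omega> = count_proc \<sigma> t \<omega>"
  proof (cases "\<sigma> \<omega> \<le> ereal t")
    case True
    have "\<sigma> \<omega> \<le> ereal s" if "t < s" for s
      using True that by (meson ereal_less_eq(3) less_imp_le order_trans)
    then show ?thesis
      using True unfolding eventually_at_right_field
      by (intro exI[of _ "t + 1"]) (auto simp: count_proc_def)
  next
    case False
    then obtain d where d: "ereal t < ereal d" "ereal d < \<sigma> \<omega>"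
      using ereal_dense2[of "ereal t" "\<sigma> \<omega>"] by (auto simp: not_le)
    have "\<not> \<sigma> \<omega> \<le> ereal s" if "s < d" for s
      using d(2) that by (meson ereal_less_eq(3) less_imp_le not_le order_trans)
    then show ?thesis
      using False d(1) unfolding eventually_at_right_field
      by (intro exI[of _ d]) (auto simp: count_proc_def)
  qed
  then show "continuous (at_right t) (\<lambda>s. count_proc \<sigma> s \<omega>)"
    by (simp add: continuous_within tendsto_eventually)
qed

lemma path_measure_count_proc_eq_0:
  assumes "\<omega> \<in> space M" "0 \<le> \<sigma> \<omega>" "0 \<le> t" "\<sigma> \<omega> \<noteq> ereal t"
  shows "emeasure (path_measure (count_proc \<sigma>) \<omega>) {t} = 0"
proof (cases "\<sigma> \<omega> < ereal t")
  case True
  then obtain s where s: "\<sigma> \<omega> = ereal s" using assms(2) by (cases "\<sigma> \<omega>") auto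
  have "emeasure (path_measure (count_proc \<sigma>) \<omega>) {t} \<le> emeasure (path_measure (count_proc \<sigma>) \<omega>) {s<..t}"
    using True s by (intro emeasure_mono) auto
  also have "\<dots> = 0"
    using path_measure_greaterThanAtMost[OF count_proc_increasing assms(1), of s t \<sigma>] True s assms(2)
    by (simp add: count_proc_def)
  finally show ?thesis by simp
next
  case False
  have "emeasure (path_measure (count_proc \<sigma>) \<omega>) {t} \<le> emeasure (path_measure (count_proc \<sigma>) \<omega>) {0..t}"
    using assms(3) by (intro emeasure_mono) auto
  also have "\<dots> = 0"
    using path_measure_atLeastAtMost[OF count_proc_increasing assms(1,3), of \<sigma>] False assms(4)
    by (simp add: count_proc_def)
  finally show ?thesis by simp
qed

section \<open>Hitting times of right-continuous paths\<close>

lemma hit_time_nonneg: "0 \<le> hit_time X b \<omega>"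
  unfolding hit_time_def by (intro Inf_greatest) auto

lemma hit_time_leI: "0 \<le> t \<Longrightarrow> b t \<le> X t \<omega> \<Longrightarrow> hit_time X b \<omega> \<le> ereal t"
  unfolding hit_time_def by (intro Inf_lower) auto

text \<open>If the path were negative at the infimum, right-continuity would keep it negative for a
  while longer and push the infimum up. The statement is pathwise because it serves twice: for
  \<open>X - b\<close>, and for increasing processes against a constant level.\<close>

lemma hit_time_attained:
  assumes cont: "\<And>t. 0 \<le> t \<Longrightarrow> continuous (at_right t) (Y :: real \<Rightarrow> real)"
    and Y: "\<And>t. X t \<omega> - b t = Y t"
    and fin: "hit_time X b \<omega> < \<infinity>"
  obtains t where "hit_time X b \<omega> = ereal t" "0 \<le> t" "0 \<le> Y t" "\<And>s. 0 \<le> s \<Longrightarrow> s < t \<Longrightarrow> Y s < 0"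
proof -
  from fin hit_time_nonneg[of X b \<omega>] obtain t where t: "hit_time X b \<omega> = ereal t" "0 \<le> t"
    by (cases "hit_time X b \<omega>") auto
  have before: "Y s < 0" if "0 \<le> s" "s < t" for s
    using hit_time_leI[of s b X \<omega>] that t Y[of s] by force
  have "0 \<le> Y t"
  proof (rule ccontr)
    assume "\<not> 0 \<le> Y t"
    then have "\<forall>\<^sub>F s in at_right t. Y s < 0"
      using cont[OF t(2)] by (intro order_tendstoD) (auto simp: continuous_within)
    then obtain d where d: "t < d" "\<And>s. t < s \<Longrightarrow> s < d \<Longrightarrow> Y s < 0"
      unfolding eventually_at_right_field by blast
    have "ereal d \<le> hit_time X b \<omega>"
      unfolding hit_time_def
    proof (rule Inf_greatest)
      fix x assume "x \<in> ereal ` {t. 0 \<le> t \<and> 0 \<le> X t \<omega> - b t}"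
      then obtain s where s: "x = ereal s" "0 \<le> s" "0 \<le> Y s" using Y by auto
      have "d \<le> s"
        using s before[of s] d(2)[of s] \<open>\<not> 0 \<le> Y t\<close> by (cases s t rule: linorder_cases) force+
      then show "ereal d \<le> x" using s by simp
    qed
    with t d(1) show False by simp
  qed
  with t before that show thesis by blast
qed

section \<open>Doleans measures of compensators and first passage times\<close>

context usual_filtration
begin

lemma dual_predictable_projection_doleans:
  assumes dual: "dual_predictable_projection M F A \<Lambda>"
    and A: "increasing_process M A" "\<And>t. 0 \<le> t \<Longrightarrow> A t \<in> borel_measurable M"
  shows "doleans \<Lambda> = doleans A"
proof (rule measure_eqI)
  fix S assume "S \<in> sets (doleans \<Lambda>)"
  then have S: "S \<in> sets (predictable_sigma M F)" by simp
  have L: "predictable_process M F \<Lambda>" "increasing_process M \<Lambda>"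
    using dual by (auto simp: dual_predictable_projection_def)
  have "(\<lambda>x. indicator S x :: real) \<in> borel_measurable (predictable_sigma M F)"
    using S by simp
  then have "predictable_process M F (\<lambda>t \<omega>. indicator S (t, \<omega>))"
    unfolding predictable_process_def by (simp add: case_prod_beta')
  with dual have "(\<integral>\<^sup>+ \<omega>. (\<integral>\<^sup>+ t. ennreal (indicator S (t, \<omega>)) \<partial>path_measure \<Lambda> \<omega>) \<partial>M) =
        (\<integral>\<^sup>+ \<omega>. (\<integral>\<^sup>+ t. ennreal (indicator S (t, \<omega>)) \<partial>path_measure A \<omega>) \<partial>M)"
    unfolding dual_predictable_projection_def by (elim conjE allE[of _ "\<lambda>t \<omega>. indicator S (t, \<omega>)"]) simp
  moreover have "(\<integral>\<^sup>+ t. ennreal (indicator S (t, \<omega>)) \<partial>path_measure W \<omega>)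
      = emeasure (path_measure W \<omega>) ((\<lambda>t. (t, \<omega>)) -` S)" if "\<omega> \<in> space M" for W \<omega>
  proof -
    have "(\<lambda>t. ennreal (indicator S (t, \<omega>))) = indicator ((\<lambda>t. (t, \<omega>)) -` S)"
      by (auto simp: indicator_def)
    then show ?thesis using predictable_section[OF S that] by simp
  qed
  ultimately show "emeasure (doleans \<Lambda>) S = emeasure (doleans A) S"
    using emeasure_doleans[OF L(2) predictable_process_measurable_M[OF L(1)] S] emeasure_doleans[OF A S]
    by (simp cong: nn_integral_cong)
qed simp

text \<open>On a rectangle the section is empty or an interval, whose mass is an explicit value or
  increment of the path. Checking sums of processes there is enough, since rectangles determine the
  Doleans measure under the finiteness condition of \<open>doleans_eqI\<close>.\<close>

lemma rectangle_section_add: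
  assumes "increasing_process M U" "increasing_process M V" "increasing_process M W" "\<omega> \<in> space M"
    and add: "\<And>t. 0 \<le> t \<Longrightarrow> W t \<omega> = U t \<omega> + V t \<omega>"
    and S: "S \<in> rectangles"
  shows "emeasure (path_measure W \<omega>) ((\<lambda>t. (t, \<omega>)) -` S)
    = emeasure (path_measure U \<omega>) ((\<lambda>t. (t, \<omega>)) -` S) + emeasure (path_measure V \<omega>) ((\<lambda>t. (t, \<omega>)) -` S)"
  using S
proof (cases rule: rectangles_cases)
  case (zero A)
  have "(\<lambda>t. (t, \<omega>)) -` S = (if \<omega> \<in> A then {0..0} else {})" using zero by auto
  moreover have "0 \<le> U 0 \<omega>" "0 \<le> V 0 \<omega>" using assms by (auto simp: increasing_process_def)
  ultimately show ?thesis
    using path_measure_atLeastAtMost[OF assms(1,4), of 0] path_measure_atLeastAtMost[OF assms(2,4), of 0]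
      path_measure_atLeastAtMost[OF assms(3,4), of 0] add[of 0] by simp
next
  case (Ioc s t A)
  have "(\<lambda>t. (t, \<omega>)) -` S = (if \<omega> \<in> A then {s<..t} else {})" using Ioc by auto
  moreover have "U s \<omega> \<le> U t \<omega>" "V s \<omega> \<le> V t \<omega>" using assms Ioc by (auto simp: increasing_process_def)
  moreover have "W t \<omega> - W s \<omega> = (U t \<omega> - U s \<omega>) + (V t \<omega> - V s \<omega>)"
    using add[of s] add[of t] Ioc by simp
  ultimately show ?thesis
    using path_measure_greaterThanAtMost[OF assms(1,4), of s t] path_measure_greaterThanAtMost[OF assms(2,4), of s t]
      path_measure_greaterThanAtMost[OF assms(3,4), of s t] Ioc by simp
qed

lemma rectangles_predictable: "S \<in> rectangles \<Longrightarrow> S \<in> sets (predictable_sigma M F)"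
  by (simp add: sets_predictable_sigma)

lemma emeasure_doleans_add:
  assumes "increasing_process M U" "increasing_process M V" "increasing_process M W"
    and meas: "\<And>t. 0 \<le> t \<Longrightarrow> U t \<in> borel_measurable M" "\<And>t. 0 \<le> t \<Longrightarrow> V t \<in> borel_measurable M"
      "\<And>t. 0 \<le> t \<Longrightarrow> W t \<in> borel_measurable M"
    and add: "\<And>t \<omega>. \<omega> \<in> space M \<Longrightarrow> 0 \<le> t \<Longrightarrow> W t \<omega> = U t \<omega> + V t \<omega>"
    and S: "S \<in> rectangles"
  shows "emeasure (doleans W) S = emeasure (doleans U) S + emeasure (doleans V) S"
proof -
  note S' = rectangles_predictable[OF S]
  have "emeasure (doleans W) S = (\<integral>\<^sup>+\<omega>. emeasure (path_measure W \<omega>) ((\<lambda>t. (t, \<omega>)) -` S) \<partial>M)"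
    by (intro emeasure_doleans assms(3) meas(3) S')
  also have "\<dots> = (\<integral>\<^sup>+\<omega>. emeasure (path_measure U \<omega>) ((\<lambda>t. (t, \<omega>)) -` S)
      + emeasure (path_measure V \<omega>) ((\<lambda>t. (t, \<omega>)) -` S) \<partial>M)"
    by (intro nn_integral_cong rectangle_section_add[OF assms(1-3) _ add S])
  also have "\<dots> = (\<integral>\<^sup>+\<omega>. emeasure (path_measure U \<omega>) ((\<lambda>t. (t, \<omega>)) -` S) \<partial>M)
      + (\<integral>\<^sup>+\<omega>. emeasure (path_measure V \<omega>) ((\<lambda>t. (t, \<omega>)) -` S) \<partial>M)"
    by (intro nn_integral_add measurable_path_measure_section assms(1,2) meas S')
  also have "(\<integral>\<^sup>+\<omega>. emeasure (path_measure U \<omega>) ((\<lambda>t. (t, \<omega>)) -` S) \<partial>M) = emeasure (doleans U) S"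
    by (intro emeasure_doleans[symmetric] assms(1) meas(1) S')
  also have "(\<integral>\<^sup>+\<omega>. emeasure (path_measure V \<omega>) ((\<lambda>t. (t, \<omega>)) -` S) \<partial>M) = emeasure (doleans V) S"
    by (intro emeasure_doleans[symmetric] assms(2) meas(2) S')
  finally show ?thesis .
qed

lemma doleans_eqI:
  assumes U: "increasing_process M U" "\<And>t. 0 \<le> t \<Longrightarrow> U t \<in> borel_measurable M"
    and fin: "\<And>t. 0 \<le> t \<Longrightarrow> (\<integral>\<^sup>+\<omega>. ennreal (U t \<omega>) \<partial>M) < \<infinity>"
    and eq: "\<And>S. S \<in> rectangles \<Longrightarrow> emeasure (doleans U) S = emeasure (doleans V) S"
  shows "doleans U = doleans V"
proof (rule measure_eqI_generator_eq_countable[OF Int_stable_rectangles rectangles_subset eq])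
  \<comment> \<open>The time-zero slice and the unit time slabs exhaust the space. Each lies in a
    bounded time range \<open>{0..t}\<close>, so its mass is at most the expectation of
    \<open>U t\<close>, which is finite.\<close>
  let ?A = "insert ({0} \<times> space M) (range (\<lambda>i::nat. {real i<..real i + 1} \<times> space M))"
  show A: "?A \<subseteq> rectangles"
    using zero_rectangle[OF sets.top] Ioc_rectangle[OF _ _ sets.top] by (auto simp: space_F)
  show "\<Union> ?A = {0..} \<times> space M"
  proof (intro antisym)
    show "\<Union> ?A \<subseteq> {0..} \<times> space M" by auto
    have "t \<in> insert 0 (\<Union>i::nat. {real i<..real i + 1})" if "0 \<le> t" for t
    proof (cases "t = 0")
      case False
      define i where "i = nat (\<lceil>t\<rceil> - 1)"
      have "0 < \<lceil>t\<rceil>" using that False by simp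
      then have "real i = of_int \<lceil>t\<rceil> - 1" by (simp add: i_def)
      then have "t \<in> {real i<..real i + 1}" using ceiling_correct[of t] by auto
      then show ?thesis by blast
    qed simp
    then have mem: "(t, \<omega>) \<in> \<Union> ?A" if "0 \<le> t" "\<omega> \<in> space M" for t \<omega>
      using that by (cases "t = 0") fastforce+
    show "{0..} \<times> space M \<subseteq> \<Union> ?A"
    proof
      fix y :: "real \<times> 'a" assume "y \<in> {0..} \<times> space M"
      then have "(fst y, snd y) \<in> \<Union> ?A" by (intro mem) auto
      then show "y \<in> \<Union> ?A" by (simp only: prod.collapse)
    qed
  qed
  show "countable ?A" by simp
  fix a assume a: "a \<in> ?A"
  then obtain t where t: "0 \<le> t" "a \<subseteq> {0..t} \<times> space M"
  proof -
    from a consider "a = {0} \<times> space M" | i where "a = {real i<..real i + 1} \<times> space M" by auto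
    then show thesis
    proof cases
      case 1 then show ?thesis by (intro that[of 0]) auto
    next
      case (2 i) then show ?thesis by (intro that[of "real i + 1"]) auto
    qed
  qed
  have "emeasure (doleans U) a = (\<integral>\<^sup>+\<omega>. emeasure (path_measure U \<omega>) ((\<lambda>t. (t, \<omega>)) -` a) \<partial>M)"
    using A a by (intro emeasure_doleans U rectangles_predictable) auto
  also have "\<dots> \<le> (\<integral>\<^sup>+\<omega>. ennreal (U t \<omega>) \<partial>M)"
  proof (rule nn_integral_mono)
    fix \<omega> assume \<omega>: "\<omega> \<in> space M"
    have "emeasure (path_measure U \<omega>) ((\<lambda>t. (t, \<omega>)) -` a) \<le> emeasure (path_measure U \<omega>) {0..t}"
      using t by (intro emeasure_mono) auto
    then show "emeasure (path_measure U \<omega>) ((\<lambda>t. (t, \<omega>)) -` a) \<le> ennreal (U t \<omega>)"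
      using path_measure_atLeastAtMost[OF U(1) \<omega> t(1)] by simp
  qed
  also have "\<dots> < \<infinity>" using fin[OF t(1)] .
  finally show "emeasure (doleans U) a \<noteq> \<infinity>" by simp
qed (simp_all add: sets_predictable_sigma)

text \<open>With a constant boundary, \<open>hit_time\<close> is a first passage time.
  Right-continuity attains the level and monotonicity keeps the path above it, so the stochastic
  interval starting at this time is exactly a superlevel set of \<open>U\<close>; for predictable
  \<open>U\<close> the time is therefore predictable.\<close>

lemma level_time_le_iff:
  assumes U: "increasing_process M U" and \<omega>: "\<omega> \<in> space M" and t: "0 \<le> t"
  shows "hit_time U (\<lambda>_. x) \<omega> \<le> ereal t \<longleftrightarrow> x \<le> U t \<omega>"
proof
  assume le: "hit_time U (\<lambda>_. x) \<omega> \<le> ereal t"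
  then have fin: "hit_time U (\<lambda>_. x) \<omega> < \<infinity>" by (cases "hit_time U (\<lambda>_. x) \<omega>") auto
  have "continuous (at_right t) (\<lambda>t. U t \<omega> - x)" if "0 \<le> t" for t
    using U \<omega> that unfolding increasing_process_def by (intro continuous_diff continuous_const) blast
  then obtain s where "hit_time U (\<lambda>_. x) \<omega> = ereal s" "0 \<le> s" "0 \<le> U s \<omega> - x"
    using hit_time_attained[of "\<lambda>t. U t \<omega> - x" U \<omega> "\<lambda>_. x", OF _ refl fin] by metis
  moreover from this le have "U s \<omega> \<le> U t \<omega>" using U \<omega> by (simp add: increasing_process_def)
  ultimately show "x \<le> U t \<omega>" by simp
qed (use t in \<open>auto intro: hit_time_leI\<close>)

lemma level_set_predictable:
  assumes "predictable_process M F U"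
  shows "{(t, \<omega>). 0 \<le> t \<and> \<omega> \<in> space M \<and> x \<le> U t \<omega>} \<in> sets (predictable_sigma M F)"
proof -
  have "{y \<in> space (predictable_sigma M F). x \<le> (\<lambda>(t, \<omega>). U t \<omega>) y} \<in> sets (predictable_sigma M F)"
    using assms unfolding predictable_process_def by measurable
  moreover have "{(t, \<omega>). 0 \<le> t \<and> \<omega> \<in> space M \<and> x \<le> U t \<omega>}
      = {y \<in> space (predictable_sigma M F). x \<le> (\<lambda>(t, \<omega>). U t \<omega>) y}"
    by auto
  ultimately show ?thesis by simp
qed

lemma level_time_predictable:
  assumes U: "increasing_process M U" "predictable_process M F U"
  shows "predictable_time M F (hit_time U (\<lambda>_. x))"
  unfolding predictable_time_def stopping_time_F_def
proof (intro conjI ballI allI impI)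
  show "0 \<le> hit_time U (\<lambda>_. x) \<omega>" for \<omega> by (rule hit_time_nonneg)
  fix t :: real assume t: "0 \<le> t"
  have "{\<omega> \<in> space M. hit_time U (\<lambda>_. x) \<omega> \<le> ereal t} = {\<omega> \<in> space (F t). x \<le> U t \<omega>}"
    using level_time_le_iff[OF U(1) _ t] by (auto simp: space_F[OF t])
  also have "\<dots> \<in> sets (F t)"
    using predictable_process_measurable[OF U(2) t] by measurable
  finally show "{\<omega> \<in> space M. hit_time U (\<lambda>_. x) \<omega> \<le> ereal t} \<in> sets (F t)" .
next
  have "{(t, \<omega>). 0 \<le> t \<and> \<omega> \<in> space M \<and> hit_time U (\<lambda>_. x) \<omega> \<le> ereal t}
      = {(t, \<omega>). 0 \<le> t \<and> \<omega> \<in> space M \<and> x \<le> U t \<omega>}"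
    using level_time_le_iff[OF U(1)] by auto
  then show "{(t, \<omega>). 0 \<le> t \<and> \<omega> \<in> space M \<and> hit_time U (\<lambda>_. x) \<omega> \<le> ereal t} \<in> sets (predictable_sigma M F)"
    using level_set_predictable[OF U(2)] by simp
qed

end

section \<open>The left-contact time is predictable\<close>

locale boundary_hitting = usual_filtration M F
  for M :: "'a measure" and F :: "real \<Rightarrow> 'a measure" +
  fixes X :: "real \<Rightarrow> 'a \<Rightarrow> real" and b :: "real \<Rightarrow> real"
  assumes prob: "prob_space M"
    and adapted: "adapted M F X" and cadlag: "cadlag_process M X"
    and cont_b: "continuous_on UNIV b"
    and start: "\<forall>\<omega>\<in>space M. X 0 \<omega> < b 0"
    and no_contact:
      "\<forall>t\<ge>0. \<forall>\<omega>\<in>space M. ereal t < hit_time X b \<omega> \<longrightarrow> (SUP s\<in>{0..t}. Yproc X b s \<omega>) < 0"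
begin

abbreviation "\<tau> \<equiv> hit_time X b"
abbreviation "Y \<equiv> Yproc X b"

lemma tendsto_b: "(b \<longlongrightarrow> b t) (at t within S)"
  using cont_b by (simp add: continuous_on_def) (meson subset_UNIV tendsto_within_subset)

lemma Y_right_cont: "\<omega> \<in> space M \<Longrightarrow> 0 \<le> t \<Longrightarrow> continuous (at_right t) (\<lambda>t. Y t \<omega>)"
  using cadlag tendsto_b[of t "{t<..}"] unfolding Yproc_def cadlag_process_def cadlag_def continuous_within
  by (intro tendsto_diff) auto

text \<open>The strict start below the boundary excludes \<open>t = 0\<close>, so a genuine left
  limit exists. It is at most zero because \<open>Y\<close> is negative before
  \<open>\<tau>\<close>, and continuity of \<open>b\<close> transfers it between \<open>Y\<close>
  and \<open>X\<close>.\<close>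

lemma hit_time_cases:
  assumes \<omega>: "\<omega> \<in> space M" and fin: "\<tau> \<omega> < \<infinity>"
  obtains t l where "\<tau> \<omega> = ereal t" "0 < t" "0 \<le> Y t \<omega>"
    "((\<lambda>s. Y s \<omega>) \<longlongrightarrow> l) (at_left t)" "l \<le> 0" "left_lim Y t \<omega> = l" "left_lim X t \<omega> = l + b t"
proof -
  obtain t where t: "\<tau> \<omega> = ereal t" "0 \<le> t" "0 \<le> Y t \<omega>" "\<And>s. 0 \<le> s \<Longrightarrow> s < t \<Longrightarrow> Y s \<omega> < 0"
    using hit_time_attained[of "\<lambda>t. Y t \<omega>" X \<omega> b, OF Y_right_cont[OF \<omega>] _ fin] by (auto simp: Yproc_def)
  have "t \<noteq> 0" using t(3) start \<omega> by (auto simp: Yproc_def)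
  with t(2) have pos: "0 < t" by simp
  obtain m where m: "((\<lambda>s. X s \<omega>) \<longlongrightarrow> m) (at_left t)"
    using cadlag \<omega> pos unfolding cadlag_process_def cadlag_def by blast
  have l: "((\<lambda>s. Y s \<omega>) \<longlongrightarrow> m - b t) (at_left t)"
    unfolding Yproc_def by (intro tendsto_diff m tendsto_b)
  have nontriv: "\<not> trivial_limit (at_left t)" by simp
  have "\<forall>\<^sub>F s in at_left t. Y s \<omega> \<le> 0"
    unfolding eventually_at_left_field using pos t(4) by (intro exI[of _ 0]) (auto intro: less_imp_le)
  then have "m - b t \<le> 0"
    by (rule tendsto_upperbound[OF l _ nontriv])
  moreover have "left_lim Y t \<omega> = m - b t" "left_lim X t \<omega> = m"
    using tendsto_Lim[OF nontriv l] tendsto_Lim[OF nontriv m] pos by (simp_all add: left_lim_def)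
  ultimately show thesis using that[OF t(1) pos t(3) l] by simp
qed

lemma Y_bound_before:
  assumes "\<omega> \<in> space M" "0 \<le> t" "ereal t < \<tau> \<omega>"
  shows "\<exists>n. \<forall>s\<in>{0..t}. Y s \<omega> < - 1 / real (Suc n)"
proof -
  \<comment> \<open>The upper bound zero is needed first: a real \<open>SUP\<close> dominates the
    values only when these are bounded above.\<close>
  have neg: "Y s \<omega> < 0" if "0 \<le> s" "s \<le> t" for s
  proof (rule ccontr)
    assume "\<not> Y s \<omega> < 0"
    then have "\<tau> \<omega> \<le> ereal s" using that by (intro hit_time_leI) (auto simp: Yproc_def)
    also have "\<dots> \<le> ereal t" using that by simp
    finally show False using assms(3) by simp
  qed
  have S: "(SUP s\<in>{0..t}. Y s \<omega>) < 0" using no_contact assms by blast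
  then obtain n where n: "inverse (real (Suc n)) < - (SUP s\<in>{0..t}. Y s \<omega>)"
    using reals_Archimedean[of "- (SUP s\<in>{0..t}. Y s \<omega>)"] by auto
  have "Y s \<omega> < - 1 / real (Suc n)" if "0 \<le> s" "s \<le> t" for s
  proof -
    have "Y s \<omega> \<le> (SUP s\<in>{0..t}. Y s \<omega>)"
      using that neg by (intro cSUP_upper bdd_aboveI2[where M = 0]) (auto intro: less_imp_le)
    also have "\<dots> < - 1 / real (Suc n)" using n by (simp add: inverse_eq_divide)
    finally show ?thesis .
  qed
  then show ?thesis by (intro exI[of _ n]) (simp del: of_nat_Suc)
qed

lemma Y_adapted: "0 \<le> s \<Longrightarrow> s \<le> t \<Longrightarrow> Y s \<in> borel_measurable (F t)"
proof -
  assume s: "0 \<le> s" "s \<le> t"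
  have "X s \<in> borel_measurable (F t)"
  proof (rule measurable_from_subalg)
    show "subalgebra (F t) (F s)"
      using s sets_F_mono[OF s] space_F[of s] space_F[of t] by (auto simp: subalgebra_def)
    show "X s \<in> borel_measurable (F s)" using adapted s by (simp add: adapted_def)
  qed
  then show ?thesis unfolding Yproc_def[abs_def] by (intro borel_measurable_diff) auto
qed

text \<open>The contact condition supplies, for each path not yet hit by \<open>t\<close>, a uniform
  margin \<open>1 / (n + 1)\<close> below zero on \<open>{0..t}\<close>. Conversely such a margin at
  countably many times excludes a hit, because right-continuity would carry the hit to a later
  rational time.\<close>

lemma before_hit_measurable:
  assumes t: "0 \<le> t"
  shows "{\<omega> \<in> space M. ereal t < \<tau> \<omega>} \<in> sets (F t)"
proof -
  \<comment> \<open>The endpoint is added separately: for a hit exactly at \<open>t\<close>,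
    right-continuity would only yield times after \<open>t\<close>, which are not observable in
    \<open>F t\<close>.\<close>
  let ?Q = "insert t (\<rat> \<inter> {0..t})"
  have "{\<omega> \<in> space M. ereal t < \<tau> \<omega>}
      = (\<Union>n. \<Inter>s\<in>?Q. {\<omega> \<in> space (F t). Y s \<omega> \<le> - 1 / real (Suc n)})"
  proof (intro set_eqI iffI)
    fix \<omega> assume "\<omega> \<in> {\<omega> \<in> space M. ereal t < \<tau> \<omega>}"
    then have \<omega>: "\<omega> \<in> space M" "ereal t < \<tau> \<omega>" by auto
    obtain n where n: "\<forall>s\<in>{0..t}. Y s \<omega> < - 1 / real (Suc n)"
      using Y_bound_before[OF \<omega>(1) t \<omega>(2)] ..
    show "\<omega> \<in> (\<Union>n. \<Inter>s\<in>?Q. {\<omega> \<in> space (F t). Y s \<omega> \<le> - 1 / real (Suc n)})"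
      using n \<omega>(1) t by (intro UN_I[of n] INT_I CollectI conjI less_imp_le bspec[OF n]) (auto simp: space_F)
  next
    fix \<omega> assume "\<omega> \<in> (\<Union>n. \<Inter>s\<in>?Q. {\<omega> \<in> space (F t). Y s \<omega> \<le> - 1 / real (Suc n)})"
    then obtain n where n: "\<And>s. s \<in> ?Q \<Longrightarrow> Y s \<omega> \<le> - 1 / real (Suc n)" and "\<omega> \<in> space (F t)"
      by blast
    then have \<omega>: "\<omega> \<in> space M" using t by (simp add: space_F)
    have "ereal t < \<tau> \<omega>"
    proof (rule ccontr)
      assume "\<not> ereal t < \<tau> \<omega>"
      then have le: "\<tau> \<omega> \<le> ereal t" by simp
      then have "\<tau> \<omega> < \<infinity>" by (cases "\<tau> \<omega>") auto
      then obtain u where u: "\<tau> \<omega> = ereal u" "0 < u" "0 \<le> Y u \<omega>"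
        using hit_time_cases[OF \<omega>] by metis
      have pos: "- 1 / real (Suc n) < 0" by simp
      have "u \<noteq> t"
      proof
        assume "u = t"
        then have "0 \<le> Y t \<omega>" using u(3) by simp
        then show False using n[OF insertI1] pos by linarith
      qed
      with le u(1) have "u < t" by simp
      have "\<forall>\<^sub>F s in at_right u. - 1 / real (Suc n) < Y s \<omega>"
      proof (rule order_tendstoD(1))
        show "((\<lambda>s. Y s \<omega>) \<longlongrightarrow> Y u \<omega>) (at_right u)"
          using Y_right_cont[OF \<omega>, of u] u(2) by (simp add: continuous_within)
        show "- 1 / real (Suc n) < Y u \<omega>" using pos u(3) by linarith
      qed
      then obtain d where d: "u < d" "\<And>s. u < s \<Longrightarrow> s < d \<Longrightarrow> - 1 / real (Suc n) < Y s \<omega>"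
        unfolding eventually_at_right_field by blast
      obtain q where q: "q \<in> \<rat>" "u < q" "q < min d t"
        using Rats_dense_in_real[of u "min d t"] d(1) \<open>u < t\<close> by auto
      have "q \<in> ?Q" using q u(2) by auto
      from n[OF this] d(2)[of q] q show False by linarith
    qed
    with \<omega> show "\<omega> \<in> {\<omega> \<in> space M. ereal t < \<tau> \<omega>}" by simp
  qed
  also have "\<dots> \<in> sets (F t)"
  proof (rule sets.countable_UN)
    have "(\<Inter>s\<in>?Q. {\<omega> \<in> space (F t). Y s \<omega> \<le> - 1 / real (Suc n)}) \<in> sets (F t)" for n
    proof (rule sets.countable_INT')
      show "countable ?Q" by (intro countable_insert countable_Int1 countable_rat)
      have "{\<omega> \<in> space (F t). Y s \<omega> \<le> - 1 / real (Suc n)} \<in> sets (F t)" if "s \<in> ?Q" for s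
      proof -
        have "Y s \<in> borel_measurable (F t)" using that t by (intro Y_adapted) auto
        then show ?thesis by measurable
      qed
      then show "(\<lambda>s. {\<omega> \<in> space (F t). Y s \<omega> \<le> - 1 / real (Suc n)}) ` ?Q \<subseteq> sets (F t)"
        by blast
    qed simp
    then show "range (\<lambda>n. \<Inter>s\<in>?Q. {\<omega> \<in> space (F t). Y s \<omega> \<le> - 1 / real (Suc n)}) \<subseteq> sets (F t)"
      by blast
  qed
  finally show ?thesis .
qed

text \<open>The set is the stochastic interval from \<open>\<tau>\<^sub>L\<close> on. Being in it
  means that, for every margin, \<open>Y\<close> came within that margin of zero at a rational time
  before both \<open>t\<close> and \<open>\<tau>\<close>. By the contact condition this cannot
  happen for all margins while \<open>t < \<tau>\<close>, nor when the left limit at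
  \<open>\<tau>\<close> is negative. The approach to zero thus announces
  \<open>\<tau>\<^sub>L\<close>.\<close>

lemma L_graph_eq:
  "{(t, \<omega>). 0 \<le> t \<and> \<omega> \<in> space M \<and> hit_time_L X b \<omega> \<le> ereal t}
    = (\<Inter>n. \<Union>r\<in>\<rat> \<inter> {0..}. {r<..} \<times> {\<omega> \<in> space M. ereal r < \<tau> \<omega> \<and> - 1 / real (Suc n) \<le> Y r \<omega>})"
  (is "?L = (\<Inter>n. ?R n)")
proof (intro set_eqI iffI)
  fix x assume "x \<in> ?L"
  then obtain t \<omega> where x: "x = (t, \<omega>)" and t: "0 \<le> t" and \<omega>: "\<omega> \<in> space M"
    and le: "hit_time_L X b \<omega> \<le> ereal t" by auto
  have L: "L_event X b \<omega>" "\<tau> \<omega> \<le> ereal t"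
    using le by (auto simp: hit_time_L_def split: if_splits)
  have "\<tau> \<omega> < \<infinity>" using L(1) by (simp add: L_event_def)
  then obtain u l where u: "\<tau> \<omega> = ereal u" "0 < u" "((\<lambda>s. Y s \<omega>) \<longlongrightarrow> l) (at_left u)" "left_lim Y u \<omega> = l"
    using hit_time_cases[OF \<omega>] by metis
  have l: "l = 0" using L(1) u by (simp add: L_event_def)
  have "x \<in> ?R n" for n
  proof -
    have "- 1 / real (Suc n) < l" by (simp add: l)
    with u(3) have "\<forall>\<^sub>F s in at_left u. - 1 / real (Suc n) < Y s \<omega>" by (rule order_tendstoD)
    then obtain d where d: "d < u" "\<And>s. d < s \<Longrightarrow> s < u \<Longrightarrow> - 1 / real (Suc n) < Y s \<omega>"
      unfolding eventually_at_left_field by blast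
    obtain r where r: "r \<in> \<rat>" "max d 0 < r" "r < u"
      using Rats_dense_in_real[of "max d 0" u] d(1) u(2) by auto
    have "r < t" using r L(2) u(1) by simp
    moreover have "- 1 / real (Suc n) \<le> Y r \<omega>" using d(2)[of r] r by simp
    ultimately show ?thesis
      using r u(1) \<omega> unfolding x by (intro UN_I[of r]) (auto simp del: of_nat_Suc)
  qed
  then show "x \<in> (\<Inter>n. ?R n)" by blast
next
  fix x assume x_in: "x \<in> (\<Inter>n. ?R n)"
  obtain t \<omega> where x: "x = (t, \<omega>)" by (cases x)
  have r: "\<exists>r. 0 \<le> r \<and> r < t \<and> ereal r < \<tau> \<omega> \<and> - 1 / real (Suc n) \<le> Y r \<omega>" for n
  proof -
    have "(t, \<omega>) \<in> ?R n" using x_in unfolding x by (rule INT_D) simp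
    then show ?thesis by (auto simp del: of_nat_Suc)
  qed
  have \<omega>: "\<omega> \<in> space M" 
  proof -
    have "(t, \<omega>) \<in> ?R 0" using x_in unfolding x by (rule INT_D) simp
    then show ?thesis by auto
  qed
  have t: "0 \<le> t" using r[of 0] by auto
  have "\<not> ereal t < \<tau> \<omega>"
  proof
    assume lt: "ereal t < \<tau> \<omega>"
    obtain n where n: "\<forall>s\<in>{0..t}. Y s \<omega> < - 1 / real (Suc n)"
      using Y_bound_before[OF \<omega> t lt] ..
    obtain r where "0 \<le> r" "r < t" "- 1 / real (Suc n) \<le> Y r \<omega>" using r[of n] by blast
    with n[rule_format, of r] show False by simp
  qed
  then have le: "\<tau> \<omega> \<le> ereal t" by simp
  then have fin: "\<tau> \<omega> < \<infinity>" by (cases "\<tau> \<omega>") auto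
  then obtain u l where u: "\<tau> \<omega> = ereal u" "0 < u" "((\<lambda>s. Y s \<omega>) \<longlongrightarrow> l) (at_left u)" "l \<le> 0" "left_lim Y u \<omega> = l"
    using hit_time_cases[OF \<omega>] by metis
  have "l = 0"
  proof (rule ccontr)
    assume "l \<noteq> 0"
    with u(4) have neg: "l < l / 2" "l / 2 < 0" by simp_all
    have "\<forall>\<^sub>F s in at_left u. Y s \<omega> < l / 2" using u(3) neg(1) by (rule order_tendstoD)
    then obtain d where d: "d < u" "\<And>s. d < s \<Longrightarrow> s < u \<Longrightarrow> Y s \<omega> < l / 2"
      unfolding eventually_at_left_field by blast
    \<comment> \<open>A negative left limit keeps \<open>Y\<close> away from zero on all of
      \<open>[0, u)\<close>: after \<open>d\<close> by the bound \<open>l / 2\<close>, and up to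
      \<open>e\<close> by the contact condition. Choosing \<open>e\<close> beyond \<open>d\<close>
      leaves no uncovered time.\<close>
    obtain e where e: "max d 0 < e" "e < u" using dense[of "max d 0" u] d(1) u(2) by auto
    have "0 \<le> e" "ereal e < \<tau> \<omega>" using e u(1) by auto
    then have "\<exists>n. \<forall>s\<in>{0..e}. Y s \<omega> < - 1 / real (Suc n)"
      by (rule Y_bound_before[OF \<omega>])
    then obtain n where n: "\<forall>s\<in>{0..e}. Y s \<omega> < - 1 / real (Suc n)" ..
    obtain m where m: "inverse (real (Suc m)) < - (l / 2)"
      using reals_Archimedean[of "- (l / 2)"] neg(2) by auto
    \<comment> \<open>One margin smaller than both bounds, so that the approach within it is
      contradicted on either side of \<open>e\<close>.\<close>
    define k where "k = max n m"
    have k: "1 / real (Suc k) \<le> 1 / real (Suc n)" "1 / real (Suc k) \<le> inverse (real (Suc m))"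
      by (auto simp: k_def field_simps)
    obtain r where r: "0 \<le> r" "ereal r < \<tau> \<omega>" "- 1 / real (Suc k) \<le> Y r \<omega>" using r[of k] by blast
    show False
    proof (cases "r \<le> e")
      case True
      then show False using n[rule_format, of r] r(1,3) k(1) by simp
    next
      case False
      then show False using d(2)[of r] e r u(1) k(2) m by simp
    qed
  qed
  then have "L_event X b \<omega>" using fin u by (simp add: L_event_def)
  then show "x \<in> ?L" using le t \<omega> x by (simp add: hit_time_L_def)
qed

lemma L_graph_predictable:
  "{(t, \<omega>). 0 \<le> t \<and> \<omega> \<in> space M \<and> hit_time_L X b \<omega> \<le> ereal t} \<in> sets (predictable_sigma M F)"
proof -
  have "{r<..} \<times> {\<omega> \<in> space M. ereal r < \<tau> \<omega> \<and> - 1 / real (Suc n) \<le> Y r \<omega>} \<in> sets (predictable_sigma M F)"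
    if r: "0 \<le> r" for r n
  proof (rule ray_predictable[OF r])
    have "{\<omega> \<in> space (F r). - 1 / real (Suc n) \<le> Y r \<omega>} \<in> sets (F r)"
      using Y_adapted[OF r order_refl] by measurable
    moreover have "{\<omega> \<in> space M. ereal r < \<tau> \<omega> \<and> - 1 / real (Suc n) \<le> Y r \<omega>}
        = {\<omega> \<in> space M. ereal r < \<tau> \<omega>} \<inter> {\<omega> \<in> space (F r). - 1 / real (Suc n) \<le> Y r \<omega>}"
      using r by (auto simp: space_F)
    ultimately show "{\<omega> \<in> space M. ereal r < \<tau> \<omega> \<and> - 1 / real (Suc n) \<le> Y r \<omega>} \<in> sets (F r)"
      using before_hit_measurable[OF r] by simp
  qed
  then have "(\<Union>r\<in>\<rat> \<inter> {0..}. {r<..} \<times> {\<omega> \<in> space M. ereal r < \<tau> \<omega> \<and> - 1 / real (Suc n) \<le> Y r \<omega>})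
      \<in> sets (predictable_sigma M F)" for n
    by (intro sets.countable_UN'' countable_Int1 countable_rat) simp_all
  then show ?thesis
    unfolding L_graph_eq by (intro sets.countable_INT') auto
qed

text \<open>\<open>L\<close> and \<open>G\<close> exhaust the finite hitting times, since the left
  limit of \<open>Y\<close> at \<open>\<tau>\<close> cannot be positive.\<close>

lemma count_proc_split:
  assumes "\<omega> \<in> space M"
  shows "count_proc \<tau> t \<omega> = count_proc (hit_time_L X b) t \<omega> + count_proc (hit_time_G X b) t \<omega>"
proof (cases "\<tau> \<omega> < \<infinity>")
  case True
  from hit_time_cases[OF assms True] obtain u l where "\<tau> \<omega> = ereal u" "l \<le> 0" "left_lim Y u \<omega> = l"
    by metis
  then show ?thesis
    by (auto simp: count_proc_def hit_time_L_def hit_time_G_def L_event_def G_event_def)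
next
  case False
  then show ?thesis
    by (auto simp: count_proc_def hit_time_L_def hit_time_G_def)
qed

text \<open>This makes \<open>A\<^sup>L\<close> a candidate for its own compensator: it is
  predictable and increasing, so equality of Doleans measures forces it to coincide with
  \<open>\<Lambda>L\<close>.\<close>

lemma count_proc_L_predictable: "predictable_process M F (count_proc (hit_time_L X b))"
proof -
  let ?L = "{(t, \<omega>). 0 \<le> t \<and> \<omega> \<in> space M \<and> hit_time_L X b \<omega> \<le> ereal t}"
  have "(indicator ?L :: _ \<Rightarrow> real) \<in> borel_measurable (predictable_sigma M F)"
    using L_graph_predictable by (rule borel_measurable_indicator)
  moreover have "(\<lambda>(t, \<omega>). count_proc (hit_time_L X b) t \<omega>) x = indicator ?L x"
    if "x \<in> space (predictable_sigma M F)" for x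
    using that by (auto simp: count_proc_def indicator_def split: if_splits)
  ultimately show ?thesis
    unfolding predictable_process_def by (subst measurable_cong) auto
qed

lemma count_proc_measurable:
  assumes t: "0 \<le> t"
  shows "count_proc \<tau> t \<in> borel_measurable M"
    and "count_proc (hit_time_L X b) t \<in> borel_measurable M"
    and "count_proc (hit_time_G X b) t \<in> borel_measurable M"
proof -
  have "{\<omega> \<in> space M. ereal t < \<tau> \<omega>} \<in> sets M"
    using before_hit_measurable[OF t] by (rule sets_F_M[OF t])
  then have "(\<lambda>\<omega>. 1 - indicator {\<omega> \<in> space M. ereal t < \<tau> \<omega>} \<omega> :: real) \<in> borel_measurable M"
    by measurable
  moreover have "count_proc \<tau> t \<omega> = 1 - indicator {\<omega> \<in> space M. ereal t < \<tau> \<omega>} \<omega>"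
    if "\<omega> \<in> space M" for \<omega>
    using that by (auto simp: count_proc_def indicator_def)
  ultimately show A: "count_proc \<tau> t \<in> borel_measurable M"
    by (subst measurable_cong) auto
  show L: "count_proc (hit_time_L X b) t \<in> borel_measurable M"
    using predictable_process_measurable_M[OF count_proc_L_predictable t] .
  have "(\<lambda>\<omega>. count_proc \<tau> t \<omega> - count_proc (hit_time_L X b) t \<omega>) \<in> borel_measurable M"
    using A L by (rule borel_measurable_diff)
  moreover have "count_proc (hit_time_G X b) t \<omega> = count_proc \<tau> t \<omega> - count_proc (hit_time_L X b) t \<omega>"
    if "\<omega> \<in> space M" for \<omega>
    using count_proc_split[OF that] by simp
  ultimately show "count_proc (hit_time_G X b) t \<in> borel_measurable M"
    by (subst measurable_cong) auto
qed

end

section \<open>Continuity of compensators\<close>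

text \<open>For a monotone right-continuous function the only possible discontinuity is a jump from
  the left. A single earlier value within \<open>e\<close> excludes a jump of size \<open>e\<close>,
  as all later values up to \<open>t\<close> lie in between.\<close>

lemma continuous_on_of_left_approx:
  fixes f :: "real \<Rightarrow> real"
  assumes mono: "\<And>s t. 0 \<le> s \<Longrightarrow> s \<le> t \<Longrightarrow> f s \<le> f t"
    and right: "\<And>t. 0 \<le> t \<Longrightarrow> continuous (at_right t) f"
    and left: "\<And>t e. 0 < t \<Longrightarrow> 0 < e \<Longrightarrow> \<exists>s. 0 \<le> s \<and> s < t \<and> f t - e < f s"
  shows "continuous_on {0..} f"
  unfolding continuous_on_eq_continuous_within
proof
  fix t :: real assume "t \<in> {0..}"
  show "continuous (at t within {0..}) f"
  proof (cases "t = 0")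
    case True
    have "at t within {0..} = at_right t"
      unfolding True by (intro at_within_nhd[of _ "{-1<..<1}"]) auto
    then show ?thesis using right[of t] True by simp
  next
    case False
    with \<open>t \<in> {0..}\<close> have t: "0 < t" by simp
    have "(f \<longlongrightarrow> f t) (at_left t)"
    proof (rule order_tendstoI)
      fix a assume "a < f t"
      then obtain s where s: "0 \<le> s" "s < t" "f t - (f t - a) < f s"
        using left[OF t, of "f t - a"] by auto
      then have "a < f r" if "s < r" for r using mono[of s r] that by simp
      then show "\<forall>\<^sub>F r in at_left t. a < f r"
        using s(2) unfolding eventually_at_left_field by blast
    next
      fix a assume a: "f t < a"
      have "f r < a" if "0 < r" "r < t" for r using mono[of r t] that a by simp
      then show "\<forall>\<^sub>F r in at_left t. f r < a"
        using t unfolding eventually_at_left_field by blast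
    qed
    then have "continuous (at t) f"
      using right[of t] t by (simp add: continuous_at_split) (simp add: continuous_within)
    then show ?thesis by (rule continuous_at_imp_continuous_within)
  qed
qed

section \<open>Graphs of first passage times and jumps of compensators\<close>

context usual_filtration
begin

text \<open>For an increasing process this is the graph of the first passage time over
  \<open>x\<close>, written as the closed stochastic interval from that time on minus the open one.
  In this form predictability is visible, and each path meets it in at most one point.\<close>

definition level_graph :: "(real \<Rightarrow> 'a \<Rightarrow> real) \<Rightarrow> real \<Rightarrow> (real \<times> 'a) set" where
  "level_graph U x = {(t, \<omega>). 0 \<le> t \<and> \<omega> \<in> space M \<and> x \<le> U t \<omega>}
     - (\<Union>r\<in>\<rat> \<inter> {0..}. {r<..} \<times> {\<omega> \<in> space M. x \<le> U r \<omega>})"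

lemma level_graph_predictable:
  assumes "predictable_process M F U"
  shows "level_graph U x \<in> sets (predictable_sigma M F)"
proof -
  have "{r<..} \<times> {\<omega> \<in> space M. x \<le> U r \<omega>} \<in> sets (predictable_sigma M F)" if r: "0 \<le> r" for r
  proof (rule ray_predictable[OF r])
    have "{\<omega> \<in> space (F r). x \<le> U r \<omega>} \<in> sets (F r)"
      using predictable_process_measurable[OF assms r] by measurable
    then show "{\<omega> \<in> space M. x \<le> U r \<omega>} \<in> sets (F r)" by (simp add: space_F[OF r])
  qed
  then have "(\<Union>r\<in>\<rat> \<inter> {0..}. {r<..} \<times> {\<omega> \<in> space M. x \<le> U r \<omega>}) \<in> sets (predictable_sigma M F)"
    by (intro sets.countable_UN'' countable_Int1 countable_rat) simp_all
  then show ?thesis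
    unfolding level_graph_def using level_set_predictable[OF assms] by (intro sets.Diff)
qed

lemma level_graph_time:
  assumes U: "increasing_process M U" and mem: "(t, \<omega>) \<in> level_graph U x"
  shows "hit_time U (\<lambda>_. x) \<omega> = ereal t"
proof (rule antisym)
  have t: "0 \<le> t" "\<omega> \<in> space M" "x \<le> U t \<omega>"
    and before: "\<And>r. r \<in> \<rat> \<Longrightarrow> 0 \<le> r \<Longrightarrow> r < t \<Longrightarrow> \<not> x \<le> U r \<omega>"
    using mem by (auto simp: level_graph_def)
  then show "hit_time U (\<lambda>_. x) \<omega> \<le> ereal t" using level_time_le_iff[OF U] by simp
  show "ereal t \<le> hit_time U (\<lambda>_. x) \<omega>"
  proof (rule ccontr)
    assume lt: "\<not> ereal t \<le> hit_time U (\<lambda>_. x) \<omega>"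
    then obtain s where s: "hit_time U (\<lambda>_. x) \<omega> = ereal s" "0 \<le> s" "s < t"
      using hit_time_nonneg[of U "\<lambda>_. x" \<omega>] by (cases "hit_time U (\<lambda>_. x) \<omega>") auto
    then obtain r where r: "r \<in> \<rat>" "s < r" "r < t" using Rats_dense_in_real by blast
    have "hit_time U (\<lambda>_. x) \<omega> \<le> ereal r" "0 \<le> r" using s r by auto
    then have "x \<le> U r \<omega>" using level_time_le_iff[OF U t(2)] by simp
    with before[of r] r \<open>0 \<le> r\<close> show False by simp
  qed
qed

text \<open>By \<open>avoid\<close>, the unit atom of the counting process at
  \<open>\<sigma>\<close> almost surely misses each passage graph. The graph is predictable, so its
  Doleans mass, common to both processes, is zero, and almost every path measure of \<open>U\<close>
  ignores it. A jump of \<open>U\<close> would be an atom on the graph of some rational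
  level.\<close>

lemma compensator_continuous:
  assumes U: "increasing_process M U" "predictable_process M F U"
    and \<sigma>: "\<And>\<omega>. 0 \<le> \<sigma> \<omega>" "\<And>t. 0 \<le> t \<Longrightarrow> count_proc \<sigma> t \<in> borel_measurable M"
    and eq: "doleans U = doleans (count_proc \<sigma>)"
    and avoid: "\<And>x. AE \<omega> in M. \<forall>t. hit_time U (\<lambda>_. x) \<omega> = ereal t \<longrightarrow> \<sigma> \<omega> \<noteq> ereal t"
  shows "AE \<omega> in M. continuous_on {0..} (\<lambda>t. U t \<omega>)"
proof -
  let ?S = "\<lambda>x \<omega>. (\<lambda>t. (t, \<omega>)) -` level_graph U x"
  have "AE \<omega> in M. emeasure (path_measure U \<omega>) (?S x \<omega>) = 0" for x
  proof -
    note S = level_graph_predictable[OF U(2), of x]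
    have zero: "emeasure (path_measure (count_proc \<sigma>) \<omega>) (?S x \<omega>) = 0"
      if \<omega>: "\<omega> \<in> space M" and av: "\<forall>t. hit_time U (\<lambda>_. x) \<omega> = ereal t \<longrightarrow> \<sigma> \<omega> \<noteq> ereal t" for \<omega>
    proof (cases "?S x \<omega> = {}")
      case False
      then obtain t where t: "(t, \<omega>) \<in> level_graph U x" by auto
      have "s = t" if "(s, \<omega>) \<in> level_graph U x" for s
        using level_graph_time[OF U(1) t] level_graph_time[OF U(1) that] by simp
      with t have "?S x \<omega> = {t}" by blast
      moreover have "0 \<le> t" using t by (simp add: level_graph_def)
      moreover have "\<sigma> \<omega> \<noteq> ereal t" using av level_graph_time[OF U(1) t] by simp
      ultimately show ?thesis using path_measure_count_proc_eq_0[of \<omega> M \<sigma> t] \<omega> \<sigma>(1) by simp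
    qed simp
    have "AE \<omega> in M. emeasure (path_measure (count_proc \<sigma>) \<omega>) (?S x \<omega>) = 0"
      using avoid[of x] by (rule AE_mp) (intro AE_I2 impI zero)
    from nn_integral_cong_AE[OF this]
    have "(\<integral>\<^sup>+\<omega>. emeasure (path_measure (count_proc \<sigma>) \<omega>) (?S x \<omega>) \<partial>M) = 0"
      by simp
    then have "emeasure (doleans U) (level_graph U x) = 0"
      unfolding eq using emeasure_doleans[OF count_proc_increasing \<sigma>(2) S] by simp
    then have "(\<integral>\<^sup>+\<omega>. emeasure (path_measure U \<omega>) (?S x \<omega>) \<partial>M) = 0"
      using emeasure_doleans[OF U(1) predictable_process_measurable_M[OF U(2)] S] by simp
    then show ?thesis
      using measurable_path_measure_section[OF U(1) predictable_process_measurable_M[OF U(2)] S]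
      by (simp add: nn_integral_0_iff_AE)
  qed
  then have "AE \<omega> in M. \<forall>x\<in>\<rat>. emeasure (path_measure U \<omega>) (?S x \<omega>) = 0"
    by (subst AE_ball_countable[OF countable_rat]) simp
  then show ?thesis
  proof (rule AE_mp, intro AE_I2 impI)
    fix \<omega> assume \<omega>: "\<omega> \<in> space M" and null: "\<forall>x\<in>\<rat>. emeasure (path_measure U \<omega>) (?S x \<omega>) = 0"
    have mono: "U s \<omega> \<le> U t \<omega>" if "0 \<le> s" "s \<le> t" for s t
      using U(1) \<omega> that by (simp add: increasing_process_def)
    have "\<exists>s. 0 \<le> s \<and> s < t \<and> U t \<omega> - e < U s \<omega>" if t: "0 < t" and e: "0 < e" for t e
    proof (rule ccontr)
      assume "\<not> ?thesis"
      then have gap: "U s \<omega> \<le> U t \<omega> - e" if "0 \<le> s" "s < t" for s using that by force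
      \<comment> \<open>Conversion to \<open>ennreal\<close> sends negative reals to zero, so the
        final comparison of \<open>U t \<omega>\<close> with \<open>U t \<omega> - e\<close> is
        contradictory only after this sign is known.\<close>
      have nonneg: "0 \<le> U t \<omega> - e"
      proof -
        have "0 \<le> U 0 \<omega>" using U(1) \<omega> by (simp add: increasing_process_def)
        with gap[of 0] t show ?thesis by simp
      qed
      \<comment> \<open>Any level inside the gap is first reached at \<open>t\<close>, which places
        \<open>t\<close> on the null graph of \<open>x\<close>.\<close>
      obtain x where x: "x \<in> \<rat>" "U t \<omega> - e < x" "x < U t \<omega>"
        using Rats_dense_in_real[of "U t \<omega> - e" "U t \<omega>"] e by auto
      have "\<not> x \<le> U r \<omega>" if "0 \<le> r" "r < t" for r
        using gap[OF that] x(2) by simp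
      then have t_in: "(t, \<omega>) \<in> level_graph U x"
        using t x(3) \<omega> by (auto simp: level_graph_def)
      have "emeasure (path_measure U \<omega>) {t} \<le> emeasure (path_measure U \<omega>) (?S x \<omega>)"
        using t_in predictable_section[OF level_graph_predictable[OF U(2)] \<omega>, of x]
        by (intro emeasure_mono) auto
      then have "emeasure (path_measure U \<omega>) {t} = 0" using null x(1) by simp
      then have "emeasure (path_measure U \<omega>) ({0..<t} \<union> {t}) = emeasure (path_measure U \<omega>) {0..<t}"
        by (intro emeasure_Un_null_set null_setsI) simp_all
      moreover have "{0..<t} \<union> {t} = {0..t}" using t by auto
      ultimately have "emeasure (path_measure U \<omega>) {0..t} = emeasure (path_measure U \<omega>) {0..<t}"
        by (simp only:)
      also have "\<dots> \<le> ennreal (U t \<omega> - e)"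
      proof (rule ccontr)
        assume "\<not> ?thesis"
        then obtain r where "0 \<le> r" "r < t" "ennreal (U t \<omega> - e) < ennreal (U r \<omega>)"
          using path_measure_atLeastLessThan_gt[OF U(1) \<omega>, of "ennreal (U t \<omega> - e)" t] by (auto simp: not_le)
        with gap[of r] show False by (simp add: ennreal_leI leD)
      qed
      finally have "ennreal (U t \<omega>) \<le> ennreal (U t \<omega> - e)"
        using path_measure_atLeastAtMost[OF U(1) \<omega>, of t] t by simp
      then show False using nonneg e by (simp add: ennreal_le_iff)
    qed
    moreover have "continuous (at_right t) (\<lambda>t. U t \<omega>)" if "0 \<le> t" for t
      using increasing_process_right_cont[OF U(1) \<omega> that] by (simp add: continuous_within)
    ultimately show "continuous_on {0..} (\<lambda>t. U t \<omega>)"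
      by (intro continuous_on_of_left_approx mono)
  qed
qed

end

section \<open>Decomposition of the compensator\<close>

theorem theorem2p19:
  fixes M :: "'a measure" and F :: "real \<Rightarrow> 'a measure"
    and X :: "real \<Rightarrow> 'a \<Rightarrow> real" and b :: "real \<Rightarrow> real"
    and \<Lambda> \<Lambda>L \<Lambda>G :: "real \<Rightarrow> 'a \<Rightarrow> real"
  assumes "prob_space M"
    and "usual_conditions M F"
    and "adapted M F X" and "cadlag_process M X"
    and "continuous_on UNIV b"
    and "\<forall>\<omega>\<in>space M. X 0 \<omega> < b 0"
    and no_premature_left_contact:
      "\<forall>t\<ge>0. \<forall>\<omega>\<in>space M. ereal t < hit_time X b \<omega> \<longrightarrow> (SUP s\<in>{0..t}. Yproc X b s \<omega>) < 0"
    and no_predictable_crossing: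
      "\<forall>\<sigma>. predictable_time M F \<sigma> \<longrightarrow>
         (AE \<omega> in M. \<not> (\<sigma> \<omega> < \<infinity> \<and>
            left_lim X (real_of_ereal (\<sigma> \<omega>)) \<omega> < b (real_of_ereal (\<sigma> \<omega>)) \<and>
            b (real_of_ereal (\<sigma> \<omega>)) \<le> X (real_of_ereal (\<sigma> \<omega>)) \<omega>))"
    and "dual_predictable_projection M F (count_proc (hit_time X b)) \<Lambda>"
    and "dual_predictable_projection M F (count_proc (hit_time_L X b)) \<Lambda>L"
    and "dual_predictable_projection M F (count_proc (hit_time_G X b)) \<Lambda>G"
  shows "(\<forall>\<omega>\<in>space M. \<forall>t\<ge>0. count_proc (hit_time X b) t \<omega> =
            count_proc (hit_time_L X b) t \<omega> + count_proc (hit_time_G X b) t \<omega>)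
       \<and> (AE \<omega> in M. \<forall>t\<ge>0. \<Lambda> t \<omega> = \<Lambda>L t \<omega> + \<Lambda>G t \<omega>)
       \<and> (AE \<omega> in M. \<forall>t\<ge>0. \<Lambda>L t \<omega> = count_proc (hit_time_L X b) t \<omega>)
       \<and> (AE \<omega> in M. continuous_on {0..} (\<lambda>t. \<Lambda>G t \<omega>))"
proof -
  interpret boundary_hitting M F X b
    using assms(1-7) by (intro boundary_hitting.intro usual_filtration.intro boundary_hitting_axioms.intro)
  interpret prob_space M by fact
  let ?A = "count_proc \<tau>" and ?L = "count_proc (hit_time_L X b)" and ?G = "count_proc (hit_time_G X b)"
  have \<Lambda>: "predictable_process M F \<Lambda>" "increasing_process M \<Lambda>"
    and \<Lambda>L: "predictable_process M F \<Lambda>L" "increasing_process M \<Lambda>L"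
    and \<Lambda>G: "predictable_process M F \<Lambda>G" "increasing_process M \<Lambda>G"
    using assms(9-11) by (auto simp: dual_predictable_projection_def)
  note meas = count_proc_measurable
  have dol: "doleans \<Lambda> = doleans ?A" "doleans \<Lambda>L = doleans ?L" "doleans \<Lambda>G = doleans ?G"
    using dual_predictable_projection_doleans[OF assms(9) count_proc_increasing meas(1)]
      dual_predictable_projection_doleans[OF assms(10) count_proc_increasing meas(2)]
      dual_predictable_projection_doleans[OF assms(11) count_proc_increasing meas(3)] by blast+
  let ?V = "\<lambda>t \<omega>. \<Lambda>L t \<omega> + \<Lambda>G t \<omega>"
  have V: "increasing_process M ?V" "predictable_process M F ?V"
  proof -
    show "increasing_process M ?V"
      using \<Lambda>L(2) \<Lambda>G(2) unfolding increasing_process_def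
      by (intro ballI conjI allI impI add_nonneg_nonneg add_mono continuous_add) auto
    have "(\<lambda>x. (\<lambda>(t, \<omega>). \<Lambda>L t \<omega>) x + (\<lambda>(t, \<omega>). \<Lambda>G t \<omega>) x) \<in> borel_measurable (predictable_sigma M F)"
      using \<Lambda>L(1) \<Lambda>G(1) unfolding predictable_process_def by (rule borel_measurable_add)
    then show "predictable_process M F ?V"
      unfolding predictable_process_def by (simp add: case_prod_beta')
  qed
  have "doleans ?A = doleans ?V"
  \<comment> \<open>Finiteness is checked on the counting process, which is bounded by one, so no
    separate integrability of the compensators has to be established.\<close>
  proof (rule doleans_eqI[OF count_proc_increasing meas(1)])
    fix t :: real
    have "(\<integral>\<^sup>+\<omega>. ennreal (?A t \<omega>) \<partial>M) \<le> (\<integral>\<^sup>+\<omega>. 1 \<partial>M)"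
      by (intro nn_integral_mono) (simp add: count_proc_def)
    also have "\<dots> < \<infinity>" by (simp add: emeasure_space_1)
    finally show "(\<integral>\<^sup>+\<omega>. ennreal (?A t \<omega>) \<partial>M) < \<infinity>" .
  next
    fix S assume S: "S \<in> rectangles"
    have "emeasure (doleans ?A) S = emeasure (doleans ?L) S + emeasure (doleans ?G) S"
      by (intro emeasure_doleans_add count_proc_increasing meas S count_proc_split)
    also have "\<dots> = emeasure (doleans ?V) S"
      unfolding dol[symmetric]
      by (intro emeasure_doleans_add[symmetric] V \<Lambda>L \<Lambda>G S predictable_process_measurable_M refl)
    finally show "emeasure (doleans ?A) S = emeasure (doleans ?V) S" .
  qed
  then have sum: "AE \<omega> in M. \<forall>t\<ge>0. \<Lambda> t \<omega> = ?V t \<omega>"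
    using doleans_unique[OF finite_measure_axioms \<Lambda>(2,1) V] dol(1) by simp
  have L: "AE \<omega> in M. \<forall>t\<ge>0. \<Lambda>L t \<omega> = ?L t \<omega>"
    \<comment> \<open>The second predictable process in the uniqueness statement is
      \<open>A\<^sup>L\<close> itself.\<close>
    by (rule doleans_unique[OF finite_measure_axioms \<Lambda>L(2,1) count_proc_increasing count_proc_L_predictable dol(2)])
  have G: "AE \<omega> in M. continuous_on {0..} (\<lambda>t. \<Lambda>G t \<omega>)"
  proof (rule compensator_continuous[OF \<Lambda>G(2,1) _ meas(3) dol(3)])
    show "0 \<le> hit_time_G X b \<omega>" for \<omega> by (simp add: hit_time_G_def hit_time_nonneg)
    fix x
    have "AE \<omega> in M. \<not> (hit_time \<Lambda>G (\<lambda>_. x) \<omega> < \<infinity> \<and>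
            left_lim X (real_of_ereal (hit_time \<Lambda>G (\<lambda>_. x) \<omega>)) \<omega> < b (real_of_ereal (hit_time \<Lambda>G (\<lambda>_. x) \<omega>)) \<and>
            b (real_of_ereal (hit_time \<Lambda>G (\<lambda>_. x) \<omega>)) \<le> X (real_of_ereal (hit_time \<Lambda>G (\<lambda>_. x) \<omega>)) \<omega>)"
      using no_predictable_crossing level_time_predictable[OF \<Lambda>G(2,1)] by blast
    then show "AE \<omega> in M. \<forall>t. hit_time \<Lambda>G (\<lambda>_. x) \<omega> = ereal t \<longrightarrow> hit_time_G X b \<omega> \<noteq> ereal t"
    proof (rule AE_mp, intro AE_I2 impI allI notI)
      fix \<omega> t
      assume \<omega>: "\<omega> \<in> space M" and t: "hit_time \<Lambda>G (\<lambda>_. x) \<omega> = ereal t" "hit_time_G X b \<omega> = ereal t"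
        and no: "\<not> (hit_time \<Lambda>G (\<lambda>_. x) \<omega> < \<infinity> \<and>
            left_lim X (real_of_ereal (hit_time \<Lambda>G (\<lambda>_. x) \<omega>)) \<omega> < b (real_of_ereal (hit_time \<Lambda>G (\<lambda>_. x) \<omega>)) \<and>
            b (real_of_ereal (hit_time \<Lambda>G (\<lambda>_. x) \<omega>)) \<le> X (real_of_ereal (hit_time \<Lambda>G (\<lambda>_. x) \<omega>)) \<omega>)"
      have ev: "G_event X b \<omega>" and \<tau>: "\<tau> \<omega> = ereal t"
        using t(2) by (auto simp: hit_time_G_def split: if_splits)
      have fin: "\<tau> \<omega> < \<infinity>" by (simp add: \<tau>)
      \<comment> \<open>On \<open>G\<close> the left limit of \<open>X\<close> lies strictly below
        the boundary while \<open>X\<close> is at or above it at \<open>\<tau>\<close>. If this time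
        were also the passage time of \<open>\<Lambda>G\<close>, which is predictable, it would be a
        crossing of the excluded kind.\<close>
      obtain u l where "\<tau> \<omega> = ereal u" "0 \<le> Y u \<omega>" "left_lim Y u \<omega> = l" "left_lim X u \<omega> = l + b u"
        using hit_time_cases[OF \<omega> fin] by metis
      then have "left_lim X t \<omega> < b t" "b t \<le> X t \<omega>"
        using ev \<tau> by (auto simp: G_event_def Yproc_def)
      with no t(1) show False by simp
    qed
  qed
  show ?thesis
    using sum L G count_proc_split by blast
qed

end
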